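(* Let $U$ be a linear numeration system satisfying (H1), (H2) and (H3), and such that the gcd of the coefficients $a_0,\ldots,a_{k-1}$ of its linear recurrence relation is $1$. Then the following problem is decidable: given a deterministic finite automaton $\mathcal{A}$ over $A_U$ whose accepted language $L$ is contained in $\operatorname{rep}_U(\mathbb{N})$, decide whether the set $X=\{\operatorname{val}_U(w): w\in L\}\subseteq\mathbb{N}$ recognized by $\mathcal{A}$ is ultimately periodic.
   Context: A numeration system is an increasing sequence $U=(U_i)_{i\ge0}$ of integers with $U_0=1$ such that $C_U=\sup_{i\ge0}\lceil U_{i+1}/U_i\rceil$ is finite; $A_U=\{0,\ldots,C_U-1\}$. For $n\ge1$, the greedy $U$-representation $\operatorname{rep}_U(n)=w_\ell\cdots w_0$ (most significant digit first) is the unique word over $A_U$ with $n=\sum_{i=0}^\ell w_iU_i$, $w_\ell\neq0$ and $\sum_{i=0}^t w_iU_i<U_{t+1}$ for $t=0,\ldots,\ell$; $\operatorname{rep}_U(0)$ is the empty word. For a word $x=x_\ell\cdots x_0$ of integers, $\operatorname{val}_U(x)=\sum_{i=0}^\ell x_iU_i$. $U$ is linear if there exist $k\ge1$, integers $a_0,\ldots,a_{k-1}$ with $a_0\ne0$, and $N\ge0$ such that $U_{i+k}=a_{k-1}U_{i+k-1}+\cdots+a_0U_i$ for all $i\ge N$, where $k$ and then $N$ are chosen minimal; $a_0,\ldots,a_{k-1}$ are the coefficients of the recurrence relation. Hypotheses: (H1) the language $\operatorname{rep}_U(\mathbb{N})$ is regular; (H2) $\limsup_{i\to\infty}(U_{i+1}-U_i)=+\infty$;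 (H3) there exists $G\ge0$ such that $U_{i+1}-U_i\le U_{i+2}-U_{i+1}$ for all $i\ge G$. A set $X\subseteq\mathbb{N}$ is ultimately periodic if it is a finite union of arithmetic progressions and a finite set, i.e. its characteristic sequence is of the form $uv^\omega$ for finite words $u,v$. The numeration system is assumed to be given effectively (recurrence relation and initial terms), together with the constant $G$ of (H3). *)

theory Defs
  imports
    Complex_Main
    "HOL-Library.Extended_Real"
    "HOL-Library.Liminf_Limsup"
    "HOL-Library.Nat_Bijection"
    "HOL-Library.Omega_Words_Fun"
begin

section \<open>Numeration systems\<close>

definition C_U :: "(nat \<Rightarrow> nat) \<Rightarrow> nat" where
  "C_U U = (SUP i. nat \<lceil>real (U (Suc i)) / real (U i)\<rceil>)"

definition numeration_system :: "(nat \<Rightarrow> nat) \<Rightarrow> bool" where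
  "numeration_system U \<longleftrightarrow>
     strict_mono U \<and> U 0 = 1 \<and>
     bdd_above (range (\<lambda>i. nat \<lceil>real (U (Suc i)) / real (U i)\<rceil>))"

definition A_U :: "(nat \<Rightarrow> nat) \<Rightarrow> nat set" where
  "A_U U = {..<C_U U}"

text \<open>Words are lists with the most significant digit first, so the digit of weight
  \<open>U i\<close> in \<open>w\<close> is \<open>rev w ! i\<close>.\<close>

definition val_U :: "(nat \<Rightarrow> nat) \<Rightarrow> nat list \<Rightarrow> nat" where
  "val_U U w = (\<Sum>i<length w. rev w ! i * U i)"

definition greedy :: "(nat \<Rightarrow> nat) \<Rightarrow> nat list \<Rightarrow> bool" where
  "greedy U w \<longleftrightarrow>
     w \<in> lists (A_U U) \<and> w \<noteq> [] \<and> hd w \<noteq> 0 \<and>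
     (\<forall>t<length w. (\<Sum>i\<le>t. rev w ! i * U i) < U (Suc t))"

definition rep_U :: "(nat \<Rightarrow> nat) \<Rightarrow> nat \<Rightarrow> nat list" where
  "rep_U U n = (if n = 0 then [] else (THE w. greedy U w \<and> val_U U w = n))"

text \<open>The list \<open>a\<close> holds the coefficients \<open>a\<^sub>0, \<dots>, a\<^bsub>k-1\<^esub>\<close>, with \<open>k = length a\<close>.\<close>

definition satisfies_recurrence :: "(nat \<Rightarrow> nat) \<Rightarrow> int list \<Rightarrow> nat \<Rightarrow> bool" where
  "satisfies_recurrence U a N \<longleftrightarrow>
     length a \<ge> 1 \<and> a ! 0 \<noteq> 0 \<and>
     (\<forall>i\<ge>N. int (U (i + length a)) = (\<Sum>j<length a. a ! j * int (U (i + j))))"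

definition linear_recurrence_of :: "(nat \<Rightarrow> nat) \<Rightarrow> int list \<Rightarrow> nat \<Rightarrow> bool" where
  "linear_recurrence_of U a N \<longleftrightarrow>
     satisfies_recurrence U a N \<and>
     (\<forall>b M. satisfies_recurrence U b M \<longrightarrow> length a \<le> length b) \<and>
     (\<forall>b M. satisfies_recurrence U b M \<and> length b = length a \<longrightarrow> N \<le> M)"


section \<open>Finite automata\<close>

text \<open>The states are \<open>{..<length (trans A)}\<close>; reading the letter \<open>d\<close> in the state \<open>q\<close>
  leads to the state \<open>trans A ! q ! d\<close>.\<close>

record dfa =
  init :: nat
  trans :: "nat list list"
  final :: "nat list"

definition dfa_over :: "nat \<Rightarrow> dfa \<Rightarrow> bool" where
  "dfa_over c A \<longleftrightarrow>
     init A < length (trans A) \<and>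
     set (final A) \<subseteq> {..<length (trans A)} \<and>
     (\<forall>row \<in> set (trans A). length row = c \<and> set row \<subseteq> {..<length (trans A)})"

definition dfa_lang :: "nat \<Rightarrow> dfa \<Rightarrow> nat list set" where
  "dfa_lang c A =
     {w \<in> lists {..<c}. foldl (\<lambda>q d. trans A ! q ! d) (init A) w \<in> set (final A)}"

definition regular_over :: "nat \<Rightarrow> nat list set \<Rightarrow> bool" where
  "regular_over c L \<longleftrightarrow> (\<exists>A. dfa_over c A \<and> dfa_lang c A = L)"


section \<open>The hypotheses and the property to be decided\<close>

definition H1 :: "(nat \<Rightarrow> nat) \<Rightarrow> bool" where
  "H1 U \<longleftrightarrow> regular_over (C_U U) (range (rep_U U))"

definition H2 :: "(nat \<Rightarrow> nat) \<Rightarrow> bool" where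
  "H2 U \<longleftrightarrow> limsup (\<lambda>i. ereal (real (U (Suc i)) - real (U i))) = \<infinity>"

definition H3_from :: "(nat \<Rightarrow> nat) \<Rightarrow> nat \<Rightarrow> bool" where
  "H3_from U G \<longleftrightarrow>
     (\<forall>i\<ge>G. int (U (i + 1)) - int (U i) \<le> int (U (i + 2)) - int (U (i + 1)))"

definition ultimately_periodic :: "nat set \<Rightarrow> bool" where
  "ultimately_periodic X \<longleftrightarrow> (\<exists>u v. v \<noteq> [] \<and> (\<lambda>n. n \<in> X) = u \<frown> v\<^sup>\<omega>)"


section \<open>Computability\<close>

datatype recf =
    Zero
  | Succ
  | Proj nat
  | Comp recf "recf list"
  | PrimRec recf recf
  | Mu recf

text \<open>\<open>rec_eval f xs y\<close>: the partial recursive function described by \<open>f\<close> is defined at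
  \<open>xs\<close> and has the value \<open>y\<close> there. Recursion and minimisation act on the first argument.\<close>

inductive rec_eval :: "recf \<Rightarrow> nat list \<Rightarrow> nat \<Rightarrow> bool" where
  zero: "rec_eval Zero xs 0"
| succ: "rec_eval Succ [x] (Suc x)"
| proj: "i < length xs \<Longrightarrow> rec_eval (Proj i) xs (xs ! i)"
| comp: "length ys = length gs \<Longrightarrow> (\<forall>i<length gs. rec_eval (gs ! i) xs (ys ! i)) \<Longrightarrow>
    rec_eval f ys z \<Longrightarrow> rec_eval (Comp f gs) xs z"
| prim_0: "rec_eval f xs y \<Longrightarrow> rec_eval (PrimRec f g) (0 # xs) y"
| prim_Suc: "rec_eval (PrimRec f g) (n # xs) r \<Longrightarrow> rec_eval g (n # r # xs) y \<Longrightarrow>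
    rec_eval (PrimRec f g) (Suc n # xs) y"
| mu: "rec_eval f (n # xs) 0 \<Longrightarrow> (\<forall>m<n. \<exists>y. rec_eval f (m # xs) (Suc y)) \<Longrightarrow>
    rec_eval (Mu f) xs n"

inductive_cases rec_evalE:
  "rec_eval Zero xs y" "rec_eval Succ xs y" "rec_eval (Proj i) xs y"
  "rec_eval (Comp f gs) xs y" "rec_eval (PrimRec f g) (0 # xs) y"
  "rec_eval (PrimRec f g) (Suc n # xs) y" "rec_eval (Mu f) xs y"

lemma rec_eval_deterministic:
  "rec_eval f xs y \<Longrightarrow> rec_eval f xs z \<Longrightarrow> y = z"
proof (induction arbitrary: z rule: rec_eval.induct)
  case (comp ys gs xs f y)
  from comp.prems obtain ys' where ys': "length ys' = length gs"
      "\<forall>i<length gs. rec_eval (gs ! i) xs (ys' ! i)" "rec_eval f ys' z"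
    by (rule rec_evalE(4)) blast
  have "ys = ys'"
    using comp.hyps(1) comp.IH(1) ys'(1,2) by (intro nth_equalityI) auto
  with comp.IH(2) ys'(3) show ?case by blast
next
  case (prim_Suc f g n xs r y)
  from prim_Suc.prems obtain r' where "rec_eval (PrimRec f g) (n # xs) r'"
      "rec_eval g (n # r' # xs) z"
    by (rule rec_evalE(6))
  with prim_Suc.IH show ?case by blast
next
  case (mu f n xs)
  from mu.prems have z0: "rec_eval f (z # xs) 0"
      and zS: "\<forall>m<z. \<exists>y. rec_eval f (m # xs) (Suc y)"
    by (rule rec_evalE(7), simp)+
  have "\<not> n < z" "\<not> z < n" using z0 zS mu.IH by (metis nat.distinct(1))+
  then show ?case by simp
next
  case (zero xs) then show ?case by (rule rec_evalE(1)) simp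
next
  case (succ x) then show ?case by (rule rec_evalE(2)) simp
next
  case (proj i xs) from proj.prems show ?case by (rule rec_evalE(3)) simp
next
  case (prim_0 f xs y g) from prim_0.prems have "rec_eval f xs z" by (rule rec_evalE(5))
  with prim_0.IH show ?case by blast
qed

definition encode_dfa :: "dfa \<Rightarrow> nat" where
  "encode_dfa A =
     list_encode [init A, list_encode (map list_encode (trans A)), list_encode (final A)]"

text \<open>An instance consists of the coefficients \<open>a\<close> of the recurrence relation, the initial
  terms \<open>us = [U 0, \<dots>, U (N + length a - 1)]\<close>, whose number determines \<open>N\<close>, a constant \<open>G\<close>
  as in \<^const>\<open>H3_from\<close>, and an automaton.\<close>

definition encode_instance :: "int list \<Rightarrow> nat list \<Rightarrow> nat \<Rightarrow> dfa \<Rightarrow> nat" where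
  "encode_instance a us G A =
     list_encode [list_encode (map int_encode a), list_encode us, G, encode_dfa A]"

end

theory Submission
  imports
    Defs
    "Jordan_Normal_Form.Determinant"
    "HOL-Library.Function_Algebras"
begin

text \<open>Let \<open>X\<close> be the recognized set, \<open>S\<close> the number of states and \<open>p\<close> the least eventual period
  of \<open>X\<close>, if there is one. The differences \<open>U (n + 1) - U n\<close> tend to infinity, so a digit \<open>1\<close>
  can be put far in front of any representation; hence the residues modulo \<open>p\<close> of the values of
  the prefixes of representations are stable under the addition of every residue that \<open>U\<close> takes
  infinitely often. These residues generate a subgroup \<open>e\<int>/p\<int>\<close>, where \<open>e\<close> divides all late terms of
  \<open>U\<close>, and prefixes with distinct residues lead to distinct states, so \<open>p \<le> S * e\<close>. Because the
  coefficients are coprime, \<open>e\<close> divides the Hankel determinant of \<open>U\<close>, which is nonzero by the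
  minimality of the recurrence. This bounds \<open>p\<close> in terms of the instance.

  For a fixed \<open>p\<close>, the numbers of elements and of non-elements of \<open>X\<close> in \<open>[U n, U (n + 1))\<close> that are
  congruent to \<open>r\<close> modulo \<open>p\<close> satisfy linear recurrences of known order. So they vanish eventually
  if and only if they vanish on an explicit window, and whether \<open>p\<close> is an eventual period is a
  finite check.\<close>

section \<open>Total computable functions\<close>

text \<open>One program has to serve every numeration system, so finiteness arguments are not
  enough: every bound must be computable from the code of the instance. Coprime coefficients alone
  do not keep the late terms of \<open>U\<close> from having a common divisor, since the initial
  terms can create one: \<open>1, 4, 6, 14, ...\<close> with
  \<open>U (n + 2) = U (n + 1) + 2 * U n\<close> is even from the second term on. They do exclude it
  for the solution with initial values \<open>0, ..., 0, 1\<close>, and a combination of shifts of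
  \<open>U\<close> equals the Hankel determinant times that solution. The linear relations behind
  the window are never computed. A dimension bound \<open>K\<close> yields a relation of order at
  most \<open>K\<close> with unknown coefficients, which suffices to carry zeros forwards from
  \<open>K\<close> consecutive ones and backwards down to index \<open>K\<close>. Asking only
  whether a whole tail vanishes avoids the harder question of isolated zeros of a
  recurrence.\<close>

text \<open>Environments are infinite sequences of which a program reads a long enough prefix, so that
  binders can be nested without arity bookkeeping.\<close>

definition computable :: "((nat \<Rightarrow> nat) \<Rightarrow> nat) \<Rightarrow> bool" where
  "computable f \<longleftrightarrow> (\<exists>p n. \<forall>e. \<forall>m\<ge>n. rec_eval p (map e [0..<m]) (f e))"

definition decidable :: "((nat \<Rightarrow> nat) \<Rightarrow> bool) \<Rightarrow> bool" where
  "decidable P \<longleftrightarrow> computable (\<lambda>e. of_bool (P e))"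

named_theorems computable_intros

lemma computable_var [computable_intros]: "computable (\<lambda>e. e i)"
proof -
  have "rec_eval (Proj i) (map e [0..<m]) (e i)" if "Suc i \<le> m" for e m
    using rec_eval.proj[of i "map e [0..<m]"] that by simp
  then show ?thesis unfolding computable_def by blast
qed

lemma rec_eval_unary: "rec_eval p xs y \<Longrightarrow> rec_eval f [y] z \<Longrightarrow> rec_eval (Comp f [p]) xs z"
  by (rule rec_eval.comp[of "[y]"]) auto

lemma computable_Suc [computable_intros]: "computable f \<Longrightarrow> computable (\<lambda>e. Suc (f e))"
  unfolding computable_def by (meson rec_eval_unary rec_eval.succ)

lemma computable_const [computable_intros]: "computable (\<lambda>e. c)"
proof (induction c)
  case 0
  then show ?case unfolding computable_def using rec_eval.zero by blast
qed (rule computable_Suc)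

text \<open>\<open>F\<close> reads only finitely many entries of its environment, so finitely many
  programs are composed although the family \<open>g\<close> is infinite.\<close>

lemma computable_subst:
  assumes F: "computable F" and g: "\<And>i. computable (g i)"
  shows "computable (\<lambda>e. F (\<lambda>i. g i e))"
proof -
  obtain p n where p: "\<And>e m. n \<le> m \<Longrightarrow> rec_eval p (map e [0..<m]) (F e)"
    using F unfolding computable_def by blast
  have "\<forall>i. \<exists>q k. \<forall>e. \<forall>m\<ge>k. rec_eval q (map e [0..<m]) (g i e)"
    using g unfolding computable_def by blast
  then obtain q k where q: "\<And>i e m. k i \<le> m \<Longrightarrow> rec_eval (q i) (map e [0..<m]) (g i e)"
    by metis
  \<comment> \<open>The sum of the prefix lengths \<open>k i\<close> serves as a common bound for
    all of them.\<close>
  have "rec_eval (Comp p (map q [0..<n])) (map e [0..<m]) (F (\<lambda>i. g i e))"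
    if "(\<Sum>i<n. k i) \<le> m" for e m
  proof (rule rec_eval.comp[of "map (\<lambda>i. g i e) [0..<n]"])
    have "k i \<le> m" if "i < n" for i
      using member_le_sum[of i "{..<n}" k] that \<open>(\<Sum>i<n. k i) \<le> m\<close> by simp
    then show "\<forall>i<length (map q [0..<n]). rec_eval (map q [0..<n] ! i) (map e [0..<m])
        (map (\<lambda>i. g i e) [0..<n] ! i)"
      using q by simp
    show "rec_eval p (map (\<lambda>i. g i e) [0..<n]) (F (\<lambda>i. g i e))"
      using p by simp
  qed simp
  then show ?thesis unfolding computable_def by blast
qed

lemma computable_comp1:
  assumes "computable (\<lambda>e. F (e 0))" "computable f"
  shows "computable (\<lambda>e. F (f e))"
  using computable_subst[of "\<lambda>e. F (e 0)" "\<lambda>i. f"] assms by simp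

lemma computable_comp2:
  assumes "computable (\<lambda>e. F (e 0) (e 1))" "computable f" "computable g"
  shows "computable (\<lambda>e. F (f e) (g e))"
  using computable_subst[of "\<lambda>e. F (e 0) (e 1)" "\<lambda>i. if i = 0 then f else g"] assms by simp

lemma computable_comp3:
  assumes "computable (\<lambda>e. F (e 0) (e 1) (e 2))" "computable f" "computable g" "computable h"
  shows "computable (\<lambda>e. F (f e) (g e) (h e))"
  using computable_subst[of "\<lambda>e. F (e 0) (e 1) (e 2)"
      "\<lambda>i. if i = 0 then f else if i = 1 then g else h"] assms by simp

text \<open>Binders become shifts of the environment: the step finds the counter and the accumulator
  in positions 0 and 1 and the outer variables two places later. Arithmetic, bounded sums and
  quantifiers are all derived from this rule.\<close>

lemma computable_rec_nat [computable_intros]: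
  assumes b: "computable b" and s: "computable (\<lambda>e. s (e 0) (e 1) (\<lambda>i. e (i + 2)))"
    and c: "computable c"
  shows "computable (\<lambda>e. rec_nat (b e) (\<lambda>m r. s m r e) (c e))"
proof -
  obtain pb nb where pb: "\<And>e m. nb \<le> m \<Longrightarrow> rec_eval pb (map e [0..<m]) (b e)"
    using b unfolding computable_def by blast
  obtain ps ns where ps: "\<And>e m. ns \<le> m \<Longrightarrow>
      rec_eval ps (map e [0..<m]) (s (e 0) (e 1) (\<lambda>i. e (i + 2)))"
    using s unfolding computable_def by blast
  obtain pc nc where pc: "\<And>e m. nc \<le> m \<Longrightarrow> rec_eval pc (map e [0..<m]) (c e)"
    using c unfolding computable_def by blast
  define k where "k = max nb ns"
  have rec: "rec_eval (PrimRec pb ps) (x # map e [0..<k]) (rec_nat (b e) (\<lambda>m r. s m r e) x)"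
    for e x
  proof (induction x)
    case 0
    show ?case using pb[of k e] by (auto simp: k_def intro: rec_eval.prim_0)
  next
    case (Suc x)
    define r where "r = rec_nat (b e) (\<lambda>m r. s m r e) x"
    define e' where "e' i = (if i = 0 then x else if i = 1 then r else e (i - 2))" for i
    have "map e' [0..<k + 2] = x # r # map e [0..<k]"
      by (rule nth_equalityI) (auto simp: e'_def nth_Cons' numeral_2_eq_2 simp del: upt_Suc)
    with ps[of "k + 2" e'] have "rec_eval ps (x # r # map e [0..<k]) (s x r e)"
      by (simp add: k_def e'_def)
    with Suc show ?case by (auto simp: r_def intro: rec_eval.prim_Suc)
  qed
  \<comment> \<open>\<open>PrimRec\<close> is applied to exactly \<open>k\<close> parameters; the
    projections cut the input down to them, whatever its length \<open>m\<close>.\<close>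
  have "rec_eval (Comp (PrimRec pb ps) (pc # map Proj [0..<k])) (map e [0..<m])
      (rec_nat (b e) (\<lambda>m r. s m r e) (c e))" if "max k nc \<le> m" for e m
  proof (rule rec_eval.comp[OF _ _ rec])
    show "\<forall>i<length (pc # map Proj [0..<k]). rec_eval ((pc # map Proj [0..<k]) ! i)
        (map e [0..<m]) ((c e # map e [0..<k]) ! i)"
    proof (intro allI impI)
      fix i assume i: "i < length (pc # map Proj [0..<k])"
      show "rec_eval ((pc # map Proj [0..<k]) ! i) (map e [0..<m]) ((c e # map e [0..<k]) ! i)"
      proof (cases i)
        case 0
        then show ?thesis using pc that by simp
      next
        case (Suc j)
        then show ?thesis using i that rec_eval.proj[of j "map e [0..<m]"] by simp
      qed
    qed
  qed simp
  then show ?thesis unfolding computable_def by blast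
qed

section \<open>Arithmetic and propositional connectives\<close>

lemma computable_add [computable_intros]:
  assumes "computable f" "computable g" shows "computable (\<lambda>e. f e + g e)"
proof -
  have "x + y = rec_nat x (\<lambda>_ r. Suc r) y" for x y :: nat by (induction y) auto
  then show ?thesis
    by (simp only:) (intro computable_intros assms)
qed

lemma computable_mult [computable_intros]:
  assumes "computable f" "computable g" shows "computable (\<lambda>e. f e * g e)"
proof (rule computable_comp2[OF _ assms])
  have "x * y = rec_nat 0 (\<lambda>_ r. r + x) y" for x y :: nat by (induction y) auto
  then show "computable (\<lambda>e. e 0 * e 1)"
    by (simp only:) (intro computable_intros)
qed

lemma computable_power [computable_intros]:
  assumes "computable f" "computable g" shows "computable (\<lambda>e. f e ^ g e)"
proof (rule computable_comp2[OF _ assms])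
  have "x ^ y = rec_nat 1 (\<lambda>_ r. r * x) y" for x y :: nat by (induction y) auto
  then show "computable (\<lambda>e. e 0 ^ e 1)"
    by (simp only:) (intro computable_intros)
qed

lemma computable_fact [computable_intros]:
  assumes "computable f" shows "computable (\<lambda>e. fact (f e))"
proof (rule computable_comp1[OF _ assms])
  have "(fact x :: nat) = rec_nat 1 (\<lambda>m r. Suc m * r) x" for x :: nat by (induction x) auto
  then show "computable (\<lambda>e. fact (e 0))"
    by (simp only:) (intro computable_intros)
qed

lemma computable_diff [computable_intros]:
  assumes "computable f" "computable g" shows "computable (\<lambda>e. f e - g e)"
proof (rule computable_comp2[OF _ assms])
  have "x - 1 = rec_nat 0 (\<lambda>m _. m) x" for x :: nat by (cases x) auto
  then have *: "computable f \<Longrightarrow> computable (\<lambda>e. f e - 1)" for f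
    by (simp only:) (intro computable_intros)
  have "x - y = rec_nat x (\<lambda>_ r. r - 1) y" for x y :: nat by (induction y) auto
  \<comment> \<open>The right-hand side contains a subtraction again, so the equation is substituted
    once; as a rewrite rule it would loop.\<close>
  then have eq: "(\<lambda>e :: nat \<Rightarrow> nat. e 0 - e 1) = (\<lambda>e. rec_nat (e 0) (\<lambda>_ r. r - 1) (e 1))"
    by (rule ext)
  show "computable (\<lambda>e. e 0 - e 1)"
    by (rule ssubst[OF eq]) (intro computable_intros *)
qed

lemma computable_if [computable_intros]:
  assumes "decidable P" "computable f" "computable g"
  shows "computable (\<lambda>e. if P e then f e else g e)"
proof -
  have "(if P e then f e else g e) = of_bool (P e) * f e + (1 - of_bool (P e)) * g e" for e
    by simp
  moreover have "computable (\<lambda>e. of_bool (P e))"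
    using assms(1) by (simp only: decidable_def)
  ultimately show ?thesis
    by (simp only:) (intro computable_intros assms)
qed

lemma decidable_not [computable_intros]:
  assumes "decidable P" shows "decidable (\<lambda>e. \<not> P e)"
proof -
  have "of_bool (\<not> P e) = (1 - of_bool (P e) :: nat)" for e by simp
  then show ?thesis
    unfolding decidable_def by (simp only:) (intro computable_intros assms[unfolded decidable_def])
qed

lemma decidable_conj [computable_intros]:
  assumes "decidable P" "decidable Q" shows "decidable (\<lambda>e. P e \<and> Q e)"
  using computable_mult[of "\<lambda>e. of_bool (P e)" "\<lambda>e. of_bool (Q e)"] assms
  by (simp add: decidable_def of_bool_conj)

lemma decidable_imp [computable_intros]:
  assumes "decidable P" "decidable Q" shows "decidable (\<lambda>e. P e \<longrightarrow> Q e)"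
proof -
  have "decidable (\<lambda>e. \<not> (P e \<and> \<not> Q e))" by (intro computable_intros assms)
  then show ?thesis by simp
qed

lemma decidable_le [computable_intros]:
  assumes "computable f" "computable g" shows "decidable (\<lambda>e. f e \<le> g e)"
proof -
  have "of_bool (f e \<le> g e) = 1 - (f e - g e)" for e by simp
  then show ?thesis
    unfolding decidable_def by (simp only:) (intro computable_intros assms)
qed

lemma decidable_less [computable_intros]:
  assumes "computable f" "computable g" shows "decidable (\<lambda>e. f e < g e)"
proof -
  have "decidable (\<lambda>e. Suc (f e) \<le> g e)" by (intro computable_intros assms)
  then show ?thesis by (simp add: Suc_le_eq)
qed

lemma decidable_eq [computable_intros]:
  assumes "computable f" "computable g" shows "decidable (\<lambda>e. f e = g e)"
proof -
  have "decidable (\<lambda>e. f e \<le> g e \<and> g e \<le> f e)" by (intro computable_intros assms)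
  then show ?thesis by (simp add: order_eq_iff)
qed

lemma decidable_iff [computable_intros]:
  assumes "decidable P" "decidable Q" shows "decidable (\<lambda>e. P e \<longleftrightarrow> Q e)"
proof -
  have "decidable (\<lambda>e. (P e \<longrightarrow> Q e) \<and> (Q e \<longrightarrow> P e))" by (intro computable_intros assms)
  then show ?thesis by (simp add: iff_conv_conj_imp)
qed

section \<open>Bounded sums, bounded quantifiers and division\<close>

lemma computable_sum [computable_intros]:
  assumes c: "computable c" and g: "computable (\<lambda>e. g (e 0) (\<lambda>i. e (i + 1)))"
  shows "computable (\<lambda>e. \<Sum>i<c e. g i e)"
proof -
  have sum: "(\<Sum>i<x. g i e) = rec_nat 0 (\<lambda>m r. r + g m e) x" for x e
    by (induction x) auto
  \<comment> \<open>In the recursion the accumulator occupies position 1. The summand ignores it, so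
    its outer variables move up by one place.\<close>
  have "computable (\<lambda>e. g (e 0) (\<lambda>i. e (i + 2)))"
    using computable_subst[OF g, of "\<lambda>i e. e (if i = 0 then 0 else i + 1)"]
    by (simp add: computable_var)
  then show ?thesis
    unfolding sum by (intro computable_intros c)
qed

lemma decidable_all [computable_intros]:
  assumes "computable c" "decidable (\<lambda>e. P (e 0) (\<lambda>i. e (i + 1)))"
  shows "decidable (\<lambda>e. \<forall>i<c e. P i e)"
proof -
  have "(\<forall>i<c e. P i e) \<longleftrightarrow> (\<Sum>i<c e. if P i e then 0 else 1 :: nat) = 0" for e
    by auto
  then show ?thesis by (simp only:) (intro computable_intros assms)
qed

lemma decidable_ex [computable_intros]:
  assumes "computable c" "decidable (\<lambda>e. P (e 0) (\<lambda>i. e (i + 1)))"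
  shows "decidable (\<lambda>e. \<exists>i<c e. P i e)"
proof -
  have "decidable (\<lambda>e. \<not> (\<forall>i<c e. \<not> P i e))" by (intro computable_intros assms)
  then show ?thesis by simp
qed

lemma computable_div [computable_intros]:
  assumes "computable f" "computable g" shows "computable (\<lambda>e. f e div g e)"
proof (rule computable_comp2[OF _ assms])
  \<comment> \<open>The quotient counts the positive multiples of \<open>y\<close> up to
    \<open>x\<close>.\<close>
  have "x div y = (if y = 0 then 0 else \<Sum>i<x. if Suc i * y \<le> x then 1 else 0)" for x y :: nat
  proof (cases "y = 0")
    case False
    have "{i. i < x \<and> Suc i * y \<le> x} = {..<x div y}"
    proof -
      have "Suc i * y \<le> x \<longleftrightarrow> i < x div y" for i
        using False by (simp add: less_eq_div_iff_mult_less_eq Suc_le_eq[symmetric] del: mult_Suc)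
      moreover have "i < x" if "i < x div y" for i
        using that div_le_dividend[of x y] by linarith
      ultimately show ?thesis by auto
    qed
    then show ?thesis using False by (simp add: sum.If_cases Int_def Collect_conj_eq[symmetric])
  qed simp
  then show "computable (\<lambda>e. e 0 div e 1)"
    by (simp only:) (intro computable_intros)
qed

lemma computable_mod [computable_intros]:
  assumes "computable f" "computable g" shows "computable (\<lambda>e. f e mod g e)"
proof -
  have "x mod y = x - y * (x div y)" for x y :: nat
    by (simp add: minus_mult_div_eq_mod)
  then show ?thesis by (simp only:) (intro computable_intros assms)
qed

section \<open>Decoding of pairs and lists\<close>

lemma computable_prod_encode [computable_intros]:
  assumes "computable f" "computable g" shows "computable (\<lambda>e. prod_encode (f e, g e))"
  unfolding prod_encode_def triangle_def prod.case by (intro computable_intros assms)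

lemma computable_fst_prod_decode [computable_intros]:
  assumes "computable f" shows "computable (\<lambda>e. fst (prod_decode (f e)))"
proof (rule computable_comp1[OF _ assms])
  \<comment> \<open>Both components are at most the code, so a bounded search finds the pair; only
    the wanted component contributes to the sum.\<close>
  have "fst (prod_decode z) = (\<Sum>x<Suc z. if \<exists>y<Suc z. prod_encode (x, y) = z then x else 0)" for z
  proof -
    obtain x y where z: "z = prod_encode (x, y)"
      by (metis prod_decode_inverse surj_pair)
    have "(\<Sum>x'<Suc z. if \<exists>y<Suc z. prod_encode (x', y) = z then x' else 0) =
        (\<Sum>x'<Suc z. if x' = x then x' else 0)"
      by (intro sum.cong refl) (auto simp: z less_Suc_eq_le le_prod_encode_2)
    also have "\<dots> = x"
      using le_prod_encode_1[of x y] by (simp add: z less_Suc_eq_le del: sum.lessThan_Suc)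
    finally show ?thesis by (simp add: z)
  qed
  then show "computable (\<lambda>e. fst (prod_decode (e 0)))"
    by (simp only:) (intro computable_intros)
qed

lemma computable_snd_prod_decode [computable_intros]:
  assumes "computable f" shows "computable (\<lambda>e. snd (prod_decode (f e)))"
proof (rule computable_comp1[OF _ assms])
  have "snd (prod_decode z) = (\<Sum>y<Suc z. if \<exists>x<Suc z. prod_encode (x, y) = z then y else 0)" for z
  proof -
    obtain x y where z: "z = prod_encode (x, y)"
      by (metis prod_decode_inverse surj_pair)
    have "(\<Sum>y'<Suc z. if \<exists>x<Suc z. prod_encode (x, y') = z then y' else 0) =
        (\<Sum>y'<Suc z. if y' = y then y' else 0)"
      by (intro sum.cong refl) (auto simp: z less_Suc_eq_le le_prod_encode_1)
    also have "\<dots> = y"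
      using le_prod_encode_2[of y x] by (simp add: z less_Suc_eq_le del: sum.lessThan_Suc)
    finally show ?thesis by (simp add: z)
  qed
  then show "computable (\<lambda>e. snd (prod_decode (e 0)))"
    by (simp only:) (intro computable_intros)
qed

text \<open>A nonempty list is coded as the successor of a pair, hence the subtraction. The code 0
  of the empty list is its own tail, so iterating past the end is harmless.\<close>

definition code_tl :: "nat \<Rightarrow> nat" where
  "code_tl l = snd (prod_decode (l - 1))"

lemma computable_code_tl [computable_intros]:
  assumes "computable f" shows "computable (\<lambda>e. code_tl (f e))"
  unfolding code_tl_def by (intro computable_intros assms)

definition code_nth :: "nat \<Rightarrow> nat \<Rightarrow> nat" where
  "code_nth l i = fst (prod_decode (rec_nat l (\<lambda>_ r. code_tl r) i - 1))"

text \<open>A list is never longer than its code, so \<open>l\<close> itself bounds the number of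
  tails to inspect.\<close>

definition code_length :: "nat \<Rightarrow> nat" where
  "code_length l = (\<Sum>i<l. if rec_nat l (\<lambda>_ r. code_tl r) i = 0 then 0 else 1)"

lemma code_drop:
  "rec_nat (list_encode xs) (\<lambda>_ r. code_tl r) i = list_encode (drop i xs)"
proof (induction i)
  case (Suc i)
  then show ?case
  proof (cases "drop i xs")
    case Nil
    then have "drop (Suc i) xs = []" by simp
    then show ?thesis using Suc Nil
      by (simp add: code_tl_def prod_decode_def prod_decode_aux.simps)
  next
    case (Cons y ys)
    then have "drop (Suc i) xs = ys" by (metis drop_Suc list.sel(3) tl_drop)
    then show ?thesis using Suc Cons by (simp add: code_tl_def)
  qed
qed simp

lemma code_nth [simp]: "i < length xs \<Longrightarrow> code_nth (list_encode xs) i = xs ! i"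
  by (simp add: code_nth_def code_drop Cons_nth_drop_Suc[symmetric])

lemma length_le_list_encode: "length xs \<le> list_encode xs"
proof (induction xs)
  case (Cons x xs)
  then show ?case using le_prod_encode_2[of "list_encode xs" x] by simp
qed simp

lemma list_encode_eq_0_iff: "list_encode xs = 0 \<longleftrightarrow> xs = []"
  by (cases xs) auto

lemma code_length [simp]: "code_length (list_encode xs) = length xs"
proof -
  have "code_length (list_encode xs) = (\<Sum>i<list_encode xs. if length xs \<le> i then 0 else 1)"
    by (simp add: code_length_def code_drop list_encode_eq_0_iff)
  also have "\<dots> = (\<Sum>i<length xs. 1)"
    using length_le_list_encode[of xs] by (intro sum.mono_neutral_cong_right) auto
  finally show ?thesis by simp
qed

lemma computable_code_nth [computable_intros]:
  assumes "computable f" "computable g" shows "computable (\<lambda>e. code_nth (f e) (g e))"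
  unfolding code_nth_def by (intro computable_intros assms)

lemma computable_code_length [computable_intros]:
  assumes "computable f" shows "computable (\<lambda>e. code_length (f e))"
  by (rule computable_comp1[OF _ assms]) (unfold code_length_def, intro computable_intros)

section \<open>Integer sequences satisfying a linear recurrence\<close>

definition recurrent :: "int list \<Rightarrow> (nat \<Rightarrow> int) \<Rightarrow> bool" where
  "recurrent a v \<longleftrightarrow> (\<forall>n. v (n + length a) = (\<Sum>j<length a. a ! j * v (n + j)))"

lemma recurrent_of_satisfies_recurrence:
  assumes "satisfies_recurrence U a N"
  shows "recurrent a (\<lambda>n. int (U (N + n)))"
  unfolding recurrent_def
proof
  fix n
  have "int (U (N + n + length a)) = (\<Sum>j<length a. a ! j * int (U (N + n + j)))"
    using assms by (simp add: satisfies_recurrence_def)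
  then show "int (U (N + (n + length a))) = (\<Sum>j<length a. a ! j * int (U (N + (n + j))))"
    by (simp only: add.assoc)
qed

lemma recurrent_combination:
  assumes "recurrent a v"
  shows "recurrent a (\<lambda>n. \<Sum>i<m. x i * v (n + i))"
  unfolding recurrent_def
proof
  fix n
  have "(\<Sum>i<m. x i * v (n + length a + i)) = (\<Sum>i<m. x i * (\<Sum>j<length a. a ! j * v (n + i + j)))"
    using assms[unfolded recurrent_def, rule_format, of "n + i" for i]
    by (simp only: ac_simps)
  also have "\<dots> = (\<Sum>j<length a. a ! j * (\<Sum>i<m. x i * v (n + j + i)))"
    unfolding sum_distrib_left by (subst sum.swap) (simp add: ac_simps)
  finally show "(\<Sum>i<m. x i * v (n + length a + i)) = \<dots>" .
qed

lemma recurrent_dvd: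
  assumes v: "recurrent a v" and init: "\<And>n. n < length a \<Longrightarrow> h dvd v n"
  shows "h dvd v n"
proof (induction n rule: less_induct)
  case (less n)
  show ?case
  proof (cases "n < length a")
    case False
    then have "v n = (\<Sum>j<length a. a ! j * v (n - length a + j))"
      using v[unfolded recurrent_def, rule_format, of "n - length a"] by simp
    also have "h dvd \<dots>"
      using less False by (intro dvd_sum dvd_mult) simp
    finally show ?thesis .
  qed (use init in simp)
qed

lemma recurrent_eq_0:
  assumes "recurrent a v" "\<And>n. n < length a \<Longrightarrow> v n = 0"
  shows "v n = 0"
  \<comment> \<open>Divisibility by 0 means being 0.\<close>
  using recurrent_dvd[of a v 0 n] assms by simp

text \<open>A prime dividing a tail of the sequence can be pushed back past the first coefficient
  that it does not divide.\<close>

lemma recurrent_prime_dvd_back: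
  assumes v: "recurrent a v" and q: "prime q" and gcd: "Gcd (set a) = 1" and a: "a \<noteq> []"
    and tail: "\<And>n. n \<ge> M \<Longrightarrow> q dvd v n"
  shows "q dvd v (length a - 1)"
proof -
  define k where "k = length a"
  have "\<exists>j<k. \<not> q dvd a ! j"
  proof (rule ccontr)
    assume "\<not> ?thesis"
    then have "q dvd Gcd (set a)" by (auto intro!: Gcd_greatest simp: in_set_conv_nth k_def)
    then show False using gcd q by (simp add: not_prime_unit)
  qed
  then obtain j where j: "j < k" "\<not> q dvd a ! j" and min: "\<And>i. i < j \<Longrightarrow> q dvd a ! i"
    using exists_least_iff[of "\<lambda>j. j < k \<and> \<not> q dvd a ! j"] by (metis less_trans)
  \<comment> \<open>The recurrence at \<open>n - j\<close> expresses \<open>a ! j * v n\<close> by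
    later terms and by earlier terms whose coefficients \<open>q\<close> divides. It needs
    \<open>n \<ge> j\<close>, and \<open>j \<le> length a - 1\<close> lets the descent reach the
    wanted index.\<close>
  have "\<forall>n\<ge>M - d. n \<ge> j \<longrightarrow> q dvd v n" for d
  proof (induction d)
    case 0
    then show ?case using tail by simp
  next
    case (Suc d)
    show ?case
    proof (intro allI impI)
      fix n assume n: "M - Suc d \<le> n" "j \<le> n"
      have later: "q dvd v m" if "n < m" for m
        using Suc.IH that n by auto
      have split: "{..<k} = insert j ({..<j} \<union> {Suc j..<k})" using j by auto
      have "v (n - j + k) = (\<Sum>i<k. a ! i * v (n - j + i))"
        using v by (simp add: recurrent_def k_def)
      also have "\<dots> = a ! j * v n + ((\<Sum>i<j. a ! i * v (n - j + i)) +
          (\<Sum>i=Suc j..<k. a ! i * v (n - j + i)))"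
        unfolding split using n by (subst sum.insert, simp, simp) (subst sum.union_disjoint, auto)
      finally have "a ! j * v n = v (n - j + k) - ((\<Sum>i<j. a ! i * v (n - j + i)) +
          (\<Sum>i=Suc j..<k. a ! i * v (n - j + i)))" by simp
      moreover have "q dvd \<dots>"
      proof (intro dvd_diff dvd_add dvd_sum)
        show "q dvd v (n - j + k)" using n j by (intro later) simp
        show "q dvd a ! i * v (n - j + i)" if "i \<in> {..<j}" for i
          using that min by (intro dvd_mult2) simp
        show "q dvd a ! i * v (n - j + i)" if "i \<in> {Suc j..<k}" for i
          using that n by (intro dvd_mult later) (simp, linarith)
      qed
      ultimately have "q dvd a ! j * v n" by simp
      then show "q dvd v n" using j q by (simp add: prime_dvd_mult_iff)
    qed
  qed
  from this[of M] show ?thesis using j by (simp add: k_def)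
qed

text \<open>A prime dividing a whole tail of \<open>v\<close> would divide
  \<open>v (length a - 1) = 1\<close>, so the tail has gcd 1, and the gcd of its multiples by
  \<open>h\<close> is \<open>h\<close> up to sign.\<close>

lemma recurrent_tail_dvd:
  assumes v: "recurrent a v" and gcd: "Gcd (set a) = 1" and a: "a \<noteq> []"
    and last: "v (length a - 1) = 1" and e: "\<And>n. n \<ge> M \<Longrightarrow> e dvd h * v n"
  shows "e dvd h"
proof -
  define g where "g = Gcd (v ` {M..})"
  have "is_unit g"
  proof (rule ccontr)
    assume "\<not> is_unit g"
    then consider "g = 0" | q where "prime q" "q dvd g" using prime_divisorE by metis
    then obtain q where q: "prime q" "q dvd g"
    proof cases
      case 1
      \<comment> \<open>All terms from \<open>M\<close> on are 0 in this case, so any prime divides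
        them.\<close>
      have "prime (int 2)" using prime_nat_int_transfer two_is_prime_nat by blast
      with 1 show ?thesis by (intro that[of "int 2"]) simp_all
    qed
    have "q dvd v n" if "n \<ge> M" for n
      using q(2) that unfolding g_def by (meson Gcd_dvd atLeast_iff dvd_trans imageI)
    from recurrent_prime_dvd_back[OF v q(1) gcd a this] show False
      using last q(1) by (simp add: not_prime_unit)
  qed
  have "e dvd Gcd ((*) h ` v ` {M..})" using e by (auto intro!: Gcd_greatest)
  also have "Gcd ((*) h ` v ` {M..}) = normalize (h * g)"
    by (simp add: g_def Gcd_mult)
  finally have "e dvd h * g" by simp
  then show ?thesis using \<open>is_unit g\<close> by (simp add: dvd_mult_unit_iff)
qed

subsection \<open>Minimality of the recurrence\<close>

text \<open>Polynomials act on sequences with the indeterminate as the shift, which turns questions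
  about recurrences into divisibility of polynomials.\<close>

definition shift_action :: "int poly \<Rightarrow> (nat \<Rightarrow> int) \<Rightarrow> nat \<Rightarrow> int" where
  "shift_action f u n = (\<Sum>i\<le>degree f. coeff f i * u (n + i))"

lemma shift_action_atMost:
  "degree f \<le> m \<Longrightarrow> shift_action f u n = (\<Sum>i\<le>m. coeff f i * u (n + i))"
  unfolding shift_action_def by (rule sum.mono_neutral_left) (auto intro: coeff_eq_0)

lemma shift_action_add: "shift_action (f + g) u n = shift_action f u n + shift_action g u n"
  by (simp add: shift_action_atMost[of _ "max (degree f) (degree g)"] degree_add_le_max
      sum.distrib[symmetric] ring_distribs)

lemma shift_action_smult: "shift_action (smult c f) u n = c * shift_action f u n"
  by (simp add: shift_action_atMost[of _ "degree f"] sum_distrib_left ac_simps)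

lemma shift_action_pCons_0:
  "shift_action (pCons 0 f) u n = shift_action f u (Suc n)"
proof -
  have "shift_action (pCons 0 f) u n = (\<Sum>i\<le>Suc (degree f). coeff (pCons 0 f) i * u (n + i))"
    by (rule shift_action_atMost) (simp add: degree_pCons_le)
  also have "\<dots> = shift_action f u (Suc n)"
    by (subst sum.atMost_Suc_shift) (simp add: shift_action_def)
  finally show ?thesis .
qed

text \<open>The annihilator of a sequence is an ideal, because the indeterminate only
  shifts.\<close>

lemma shift_action_mult_eq_0:
  assumes "\<And>n. shift_action f u n = 0"
  shows "shift_action (f * g) u n = 0"
proof (induction g arbitrary: n)
  case (pCons c g)
  then show ?case
    using assms by (simp add: mult_pCons_right shift_action_add shift_action_smult
        shift_action_pCons_0)
qed (simp add: shift_action_def)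

definition char_poly_of :: "int list \<Rightarrow> int poly" where
  "char_poly_of a = monom 1 (length a) - (\<Sum>j<length a. monom (a ! j) j)"

lemma coeff_char_poly_of:
  "coeff (char_poly_of a) i = (if i = length a then 1 else if i < length a then - (a ! i) else 0)"
  by (simp add: char_poly_of_def coeff_sum)

lemma degree_char_poly_of: "degree (char_poly_of a) = length a"
proof (rule antisym)
  show "degree (char_poly_of a) \<le> length a"
    by (rule degree_le) (simp add: coeff_char_poly_of)
  show "length a \<le> degree (char_poly_of a)"
    by (rule le_degree) (simp add: coeff_char_poly_of)
qed

lemma shift_action_char_poly_of:
  "shift_action (char_poly_of a) u n = u (n + length a) - (\<Sum>j<length a. a ! j * u (n + j))"
proof -
  have "shift_action (char_poly_of a) u n =
      (\<Sum>i<Suc (length a). coeff (char_poly_of a) i * u (n + i))"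
    by (simp add: shift_action_def degree_char_poly_of lessThan_Suc_atMost)
  also have "\<dots> = u (n + length a) + (\<Sum>j<length a. - (a ! j) * u (n + j))"
    by (simp add: coeff_char_poly_of)
  finally show ?thesis by (simp add: sum_negf)
qed

text \<open>Gauss's lemma: the annihilator of the sequence is generated by a primitive polynomial, which
  divides the monic characteristic polynomial over the integers and so is monic itself.\<close>

lemma linear_recurrence_of_independent:
  assumes rec: "linear_recurrence_of U a N" and U: "strict_mono U" and "U 0 = 1"
    and c: "\<And>n. (\<Sum>i<length a. c i * int (U (N + n + i))) = 0" and i: "i < length a"
  shows "c i = 0"
proof (rule ccontr)
  assume ci: "c i \<noteq> 0"
  define k where "k = length a"
  define u where "u n = int (U (N + n))" for n
  define P where "P = char_poly_of a"
  have sat: "satisfies_recurrence U a N"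
    and min: "\<And>b M. satisfies_recurrence U b M \<Longrightarrow> k \<le> length b"
    using rec by (auto simp: linear_recurrence_of_def k_def)
  have P: "shift_action P u n = 0" for n
    using recurrent_of_satisfies_recurrence[OF sat]
    by (simp add: P_def shift_action_char_poly_of recurrent_def u_def)
  define kills where "kills f \<longleftrightarrow> f \<noteq> 0 \<and> (\<forall>n. shift_action f u n = 0)" for f
  define f0 where "f0 = (\<Sum>i<k. monom (c i) i)"
  have f0c: "coeff f0 j = (if j < k then c j else 0)" for j
    by (simp add: f0_def coeff_sum)
  then have f0: "f0 \<noteq> 0" "degree f0 < k"
  proof -
    show "f0 \<noteq> 0" using ci i f0c[of i] by (auto simp: k_def)
    have "degree f0 \<le> k - 1" by (rule degree_le) (auto simp: f0c)
    then show "degree f0 < k" using i by (simp add: k_def)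
  qed
  have "shift_action f0 u n = 0" for n
  proof -
    have "shift_action f0 u n = (\<Sum>i\<le>k - 1. coeff f0 i * u (n + i))"
      using f0(2) by (intro shift_action_atMost) simp
    also have "{..k - 1} = {..<k}" using i by (auto simp: k_def)
    also have "(\<Sum>i<k. coeff f0 i * u (n + i)) = 0"
      using c[of n] by (simp add: f0c k_def u_def add.assoc)
    finally show ?thesis .
  qed
  then have "kills f0" using f0 by (simp add: kills_def)
  then obtain f1 where f1: "kills f1" and f1_min: "\<And>g. kills g \<Longrightarrow> degree f1 \<le> degree g"
    using ex_has_least_nat[of kills f0 degree] by blast
  define f where "f = primitive_part f1"
  have f1_eq: "f1 = smult (content f1) f" by (simp add: f_def)
  have f1_0: "f1 \<noteq> 0" using f1 by (simp add: kills_def)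
  have f_deg: "degree f = degree f1" using f1_0 by (subst f1_eq) simp
  have f_cont: "content f = 1" using f1_0 by (simp add: f_def)
  have "content f1 * shift_action f u n = 0" for n
    using f1 unfolding kills_def by (metis f1_eq shift_action_smult)
  then have f: "kills f" using f1_0 by (simp add: kills_def f_def)
  have f_0: "f \<noteq> 0" using f by (simp add: kills_def)
  \<comment> \<open>\<open>f\<close> is not yet known to be monic, so only a multiple of
    \<open>P\<close> by a power \<open>l\<close> of the leading coefficient of \<open>f\<close> can
    be divided by it over the integers. The remainder annihilates \<open>u\<close> and vanishes by
    minimality of the degree.\<close>
  obtain g r where gr: "pseudo_divmod P f = (g, r)" by fastforce
  define l where "l = coeff f (degree f) ^ (Suc (degree P) - degree f)"
  have l_0: "l \<noteq> 0" using f_0 by (simp add: l_def)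
  have div: "smult l P = f * g + r" and r: "r = 0 \<or> degree r < degree f"
    using pseudo_divmod[OF f_0 gr] by (auto simp: l_def)
  have "shift_action r u n = 0" for n
  proof -
    have "shift_action (smult l P) u n = shift_action (f * g) u n + shift_action r u n"
      by (simp add: div shift_action_add)
    then show ?thesis
      using P f shift_action_mult_eq_0[of f u g n] by (simp add: shift_action_smult kills_def)
  qed
  then have "r = 0" using r f1_min[of r] f_deg by (force simp: kills_def)
  have P_cont: "content P = 1"
  proof -
    have "content P dvd coeff P k" by simp
    then have "content P dvd 1" by (simp add: P_def coeff_char_poly_of k_def)
    then show ?thesis by (metis is_unit_normalize normalize_content)
  qed
  \<comment> \<open>Contents are multiplicative and \<open>P\<close>, \<open>f\<close> have content
    1, so the whole factor \<open>l\<close> sits in \<open>g\<close> and cancels. This leaves a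
    factorization of \<open>P\<close> itself.\<close>
  have "content (smult l P) = content (f * g)" using div \<open>r = 0\<close> by simp
  then have g_cont: "content g = normalize l" by (simp add: content_mult P_cont f_cont)
  then have "\<bar>l\<bar> = content g" by simp
  then have "smult (sgn l) g = smult \<bar>l\<bar> (primitive_part (smult (sgn l) g))"
    using content_times_primitive_part[of "smult (sgn l) g"] l_0
    by (simp del: content_times_primitive_part add: abs_sgn_eq)
  define g' where "g' = primitive_part (smult (sgn l) g)"
  have "smult \<bar>l\<bar> P = smult (sgn l) (smult l P)"
    by (simp add: abs_sgn mult.commute)
  also have "\<dots> = f * smult (sgn l) g" using div \<open>r = 0\<close> by simp
  also have "smult (sgn l) g = smult \<bar>l\<bar> g'" unfolding g'_def by fact
  finally have "smult \<bar>l\<bar> P = smult \<bar>l\<bar> (f * g')" by simp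
  then have "smult \<bar>l\<bar> (P - f * g') = 0" by (simp add: smult_diff_right)
  then have Pf: "P = f * g'" using l_0 by simp
  have "lead_coeff P = 1" by (simp add: P_def degree_char_poly_of coeff_char_poly_of)
  then have "lead_coeff f * lead_coeff g' = 1" by (simp add: Pf lead_coeff_mult)
  then have lead: "lead_coeff f = 1 \<or> lead_coeff f = -1" by (simp add: zmult_eq_1_iff) blast
  define s where "s = lead_coeff f"
  define d where "d = degree f"
  have s2: "s * s = 1" using lead by (auto simp: s_def)
  have d_k: "d < k" using f1_min[OF \<open>kills f0\<close>] f0(2) f_deg by (simp add: d_def)
  have "coeff P 0 = coeff f 0 * coeff g' 0" by (simp add: Pf coeff_mult_0)
  then have f00: "coeff f 0 \<noteq> 0"
    using sat i by (auto simp: P_def coeff_char_poly_of satisfies_recurrence_def split: if_splits)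
  have act: "(\<Sum>j<d. coeff f j * u (n + j)) + s * u (n + d) = 0" for n
  proof -
    have "shift_action f u n = 0" using f by (simp add: kills_def)
    moreover have "shift_action f u n = (\<Sum>j<d. coeff f j * u (n + j)) + s * u (n + d)"
      unfolding shift_action_def d_def[symmetric] s_def
      by (simp add: lessThan_Suc_atMost[symmetric])
    ultimately show ?thesis by simp
  qed
  have "U N > 0" using strict_mono_less_eq[OF U, of 0 N] \<open>U 0 = 1\<close> by simp
  \<comment> \<open>A recurrence must have positive order; order 0 would force
    \<open>U N = 0\<close>.\<close>
  then have "d \<noteq> 0" using act[of 0] s2 by (intro notI) (auto simp: u_def)
  \<comment> \<open>Multiplying by the sign \<open>s\<close> makes \<open>f\<close> monic. The
    result is a recurrence of order \<open>d < k\<close> with nonzero last coefficient, against the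
    minimality of \<open>k\<close>.\<close>
  define b where "b = map (\<lambda>j. - (s * coeff f j)) [0..<d]"
  have "satisfies_recurrence U b N"
    unfolding satisfies_recurrence_def
  proof (intro conjI allI impI)
    show "1 \<le> length b" using \<open>d \<noteq> 0\<close> by (simp add: b_def)
    show "b ! 0 \<noteq> 0" using \<open>d \<noteq> 0\<close> f00 s2 by (auto simp: b_def)
    fix m assume "N \<le> m"
    then obtain n where m: "m = N + n" using le_Suc_ex by blast
    have "u (n + d) = s * (s * u (n + d))" using s2 by (simp add: mult.assoc[symmetric])
    also have "\<dots> = s * (- (\<Sum>j<d. coeff f j * u (n + j)))"
      using act[of n] by (intro arg_cong[where f = "(*) s"]) linarith
    also have "\<dots> = (\<Sum>j<d. - (s * coeff f j) * u (n + j))"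
      by (simp add: sum_distrib_left sum_negf mult.assoc)
    finally show "int (U (m + length b)) = (\<Sum>j<length b. b ! j * int (U (m + j)))"
      by (simp add: u_def b_def m add.assoc)
  qed
  from min[OF this] d_k show False by (simp add: b_def)
qed

subsection \<open>Common divisors of the tails\<close>

text \<open>Leibniz formula: \<open>fact n\<close> summands, each a product of \<open>n\<close>
  entries.\<close>

lemma abs_det_le:
  fixes A :: "int mat"
  assumes A: "A \<in> carrier_mat n n" and b: "\<And>i j. i < n \<Longrightarrow> j < n \<Longrightarrow> \<bar>A $$ (i, j)\<bar> \<le> b"
  shows "\<bar>det A\<bar> \<le> fact n * b ^ n"
proof -
  have "\<bar>det A\<bar> \<le> (\<Sum>p\<in>{p. p permutes {0..<n}}. \<bar>signof p * (\<Prod>i = 0..<n. A $$ (i, p i))\<bar>)"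
    unfolding det_def'[OF A] by (rule sum_abs)
  also have "\<dots> \<le> (\<Sum>p\<in>{p. p permutes {0..<n}}. b ^ n)"
  proof (rule sum_mono)
    fix p assume "p \<in> {p. p permutes {0..<n}}"
    then have p: "p permutes {0..<n}" by simp
    have "\<bar>signof p * (\<Prod>i = 0..<n. A $$ (i, p i))\<bar> = (\<Prod>i = 0..<n. \<bar>A $$ (i, p i)\<bar>)"
      by (simp add: abs_mult abs_prod sign_def)
    also have "\<dots> \<le> (\<Prod>i = 0..<n. b)"
      using p b by (intro prod_mono) (simp add: permutes_in_image[OF p, of i for i, simplified])
    finally show "\<bar>signof p * (\<Prod>i = 0..<n. A $$ (i, p i))\<bar> \<le> b ^ n" by simp
  qed
  also have "\<dots> = fact n * b ^ n" by (simp add: card_permutations[of "{0..<n}" n])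
  finally show ?thesis .
qed

text \<open>Cramer's rule turns the Hankel matrix of \<open>U\<close> into a multiple \<open>h * V\<close> of the
  fundamental solution \<open>V\<close> of the recurrence, and the tails of \<open>V\<close> have no common divisor.\<close>

lemma common_divisor_of_tail_le:
  assumes rec: "linear_recurrence_of U a N" and U: "strict_mono U" "U 0 = 1"
    and gcd: "Gcd (set a) = 1" and e: "\<And>n. n \<ge> M \<Longrightarrow> e dvd U n"
  shows "e \<le> fact (length a) * U (N + 2 * length a) ^ length a"
proof -
  define k where "k = length a"
  define u where "u n = int (U (N + n))" for n
  define H where "H = mat k k (\<lambda>(n, i). u (n + i))"
  have H: "H \<in> carrier_mat k k" by (simp add: H_def)
  have a: "a \<noteq> []" "k > 0"
    using rec by (auto simp: linear_recurrence_of_def satisfies_recurrence_def k_def)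
  have u: "recurrent a u"
    using rec unfolding u_def
    by (auto simp: linear_recurrence_of_def intro: recurrent_of_satisfies_recurrence)
  define h where "h = det H"
  have "h \<noteq> 0"
  proof
    assume "h = 0"
    \<comment> \<open>A kernel vector gives a relation on the first \<open>k\<close> shifts. The
      recurrence extends it to all shifts, which contradicts independence.\<close>
    then obtain x where x: "x \<in> carrier_vec k" "x \<noteq> 0\<^sub>v k" "H *\<^sub>v x = 0\<^sub>v k"
      using det_0_iff_vec_prod_zero[OF H] by (auto simp: h_def)
    have init: "(\<Sum>i<k. x $ i * u (n + i)) = 0" if "n < k" for n
    proof -
      have "(H *\<^sub>v x) $ n = (\<Sum>i<k. u (n + i) * x $ i)"
        using that x(1) by (auto simp: H_def scalar_prod_def atLeast0LessThan)
      then show ?thesis using x(3) that by (simp add: mult.commute)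
    qed
    have "(\<Sum>i<k. x $ i * u (n + i)) = 0" for n
      using recurrent_eq_0[OF recurrent_combination[OF u, where m = k and x = "\<lambda>i. x $ i"], of n] init
      by (simp add: k_def)
    then have "x $ i = 0" if "i < k" for i
      using linear_recurrence_of_independent[OF rec U, of "\<lambda>i. x $ i" i] that
      by (simp add: u_def k_def add.assoc)
    then have "x = 0\<^sub>v k" using x(1) by (intro eq_vecI) auto
    then show False using x(2) by simp
  qed
  \<comment> \<open>The last column of the adjugate solves the system whose right-hand side is
    \<open>h\<close> in the last place and 0 elsewhere.\<close>
  define x where "x i = adj_mat H $$ (i, k - 1)" for i
  define y where "y n = (\<Sum>i<k. x i * u (n + i))" for n
  have y: "recurrent a y"
    unfolding y_def by (rule recurrent_combination[OF u])
  have y_init: "y n = (if n = k - 1 then h else 0)" if n: "n < k" for n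
  proof -
    have "(H * adj_mat H) $$ (n, k - 1) = (\<Sum>i<k. u (n + i) * x i)"
      using n a adj_mat(1)[OF H]
      by (auto simp: H_def x_def scalar_prod_def atLeast0LessThan intro!: sum.cong)
    moreover have "(H * adj_mat H) $$ (n, k - 1) = (if n = k - 1 then h else 0)"
      using n a by (simp add: adj_mat(2)[OF H] h_def)
    ultimately show ?thesis by (simp add: y_def mult.commute)
  qed
  have hy: "h dvd y n" for n
    by (rule recurrent_dvd[OF y]) (use y_init in \<open>simp add: k_def\<close>)
  define v where "v n = y n div h" for n
  have yv: "y n = h * v n" for n using hy[of n] by (simp add: v_def)
  have "recurrent a v"
    unfolding recurrent_def
  proof
    fix n
    have "h * v (n + length a) = h * (\<Sum>j<length a. a ! j * v (n + j))"
      using y by (simp add: recurrent_def yv sum_distrib_left ac_simps)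
    then show "v (n + length a) = (\<Sum>j<length a. a ! j * v (n + j))"
      using \<open>h \<noteq> 0\<close> by simp
  qed
  moreover have "v (length a - 1) = 1"
    using y_init[of "k - 1"] a \<open>h \<noteq> 0\<close> by (simp add: v_def k_def)
  moreover have "int e dvd h * v n" if "n \<ge> M" for n
    unfolding yv[symmetric] y_def using that e
    by (intro dvd_sum dvd_mult) (auto simp: u_def)
  ultimately have "int e dvd h" by (rule recurrent_tail_dvd[OF _ gcd a(1)])
  then have "int e \<le> \<bar>h\<bar>" using \<open>h \<noteq> 0\<close> dvd_imp_le_int[of h "int e"] by simp
  also have "\<dots> \<le> fact k * int (U (N + 2 * k)) ^ k"
    unfolding h_def
  proof (rule abs_det_le[OF H])
    \<comment> \<open>The Hankel entries are \<open>U (N + i + j)\<close> with \<open>i\<close> and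
      \<open>j\<close> below \<open>k\<close>; this is the source of the index
      \<open>N + 2 * k\<close>.\<close>
    fix i j assume "i < k" "j < k"
    then have "U (N + (i + j)) \<le> U (N + 2 * k)"
      using U(1) by (simp add: strict_mono_less_eq)
    then show "\<bar>H $$ (i, j)\<bar> \<le> int (U (N + 2 * k))"
      using \<open>i < k\<close> \<open>j < k\<close> by (simp add: H_def u_def)
  qed
  also have "\<dots> = int (fact k * U (N + 2 * k) ^ k)" by simp
  finally show ?thesis unfolding k_def by (simp only: of_nat_le_iff)
qed

section \<open>Greedy representations\<close>

text \<open>Only meaningful for \<open>m < U l\<close>.\<close>

fun greedy_padded :: "(nat \<Rightarrow> nat) \<Rightarrow> nat \<Rightarrow> nat \<Rightarrow> nat list" where
  "greedy_padded U 0 m = []"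
| "greedy_padded U (Suc l) m = (m div U l) # greedy_padded U l (m mod U l)"

lemma length_greedy_padded [simp]: "length (greedy_padded U l m) = l"
  by (induction l arbitrary: m) auto

lemma val_U_Nil [simp]: "val_U U [] = 0"
  by (simp add: val_U_def)

lemma val_U_Cons: "val_U U (d # w) = d * U (length w) + val_U U w"
proof -
  have "(\<Sum>i<length w. rev (d # w) ! i * U i) = val_U U w"
    unfolding val_U_def by (intro sum.cong refl) (simp add: nth_append)
  moreover have "rev (d # w) ! length w = d" by (simp add: nth_append)
  ultimately show ?thesis by (simp add: val_U_def)
qed

locale numeration =
  fixes U :: "nat \<Rightarrow> nat"
  assumes numeration: "numeration_system U"
begin

lemma strict_mono_U: "strict_mono U"
  and U_0: "U 0 = 1"
  using numeration by (auto simp: numeration_system_def)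

lemma U_less_iff [simp]: "U i < U j \<longleftrightarrow> i < j"
  and U_le_iff [simp]: "U i \<le> U j \<longleftrightarrow> i \<le> j"
  using strict_mono_U by (auto simp: strict_mono_less strict_mono_less_eq)

lemma U_pos: "0 < U i"
  using U_le_iff[of 0 i] U_0 by linarith

lemma less_U: "n < U n"
proof (induction n)
  case (Suc n)
  then show ?case using U_less_iff[of n "Suc n"] by linarith
qed (simp add: U_0)

lemma val_greedy_padded: "m < U l \<Longrightarrow> val_U U (greedy_padded U l m) = m"
proof (induction l arbitrary: m)
  case (Suc l)
  then show ?case by (simp add: val_U_Cons U_pos)
qed (simp add: U_0)

lemma div_U_less_C_U:
  assumes "m < U (Suc l)" shows "m div U l < C_U U"
proof -
  have "real (m div U l) \<le> real m / real (U l)"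
    by (rule of_nat_div_le_of_nat)
  also have "\<dots> < real (U (Suc l)) / real (U l)"
    using assms U_pos by (simp add: divide_strict_right_mono)
  also have "\<dots> \<le> real_of_int \<lceil>real (U (Suc l)) / real (U l)\<rceil>" by simp
  finally have "int (m div U l) < \<lceil>real (U (Suc l)) / real (U l)\<rceil>"
    by (metis of_int_less_iff of_int_of_nat_eq)
  then have "m div U l < nat \<lceil>real (U (Suc l)) / real (U l)\<rceil>" by linarith
  also have "\<dots> \<le> C_U U"
    unfolding C_U_def using numeration
    by (intro cSUP_upper) (auto simp: numeration_system_def)
  finally show ?thesis .
qed

lemma set_greedy_padded: "m < U l \<Longrightarrow> set (greedy_padded U l m) \<subseteq> {..<C_U U}"
  by (induction l arbitrary: m) (use U_pos div_U_less_C_U in auto)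

lemma suffix_sum_eq_val_U:
  assumes "t < length w"
  shows "(\<Sum>i\<le>t. rev w ! i * U i) = val_U U (drop (length w - Suc t) w)"
proof -
  have "rev w ! i = rev (drop (length w - Suc t) w) ! i" if "i \<le> t" for i
    using assms that by (simp add: rev_nth)
  then show ?thesis
    using assms by (simp add: val_U_def lessThan_Suc_atMost[symmetric])
qed

lemma val_drop_greedy_padded:
  "m < U l \<Longrightarrow> t \<le> l \<Longrightarrow> val_U U (drop (l - t) (greedy_padded U l m)) < U t"
proof (induction l arbitrary: m)
  case (Suc l)
  show ?case
  proof (cases "t = Suc l")
    case True
    then show ?thesis using Suc.prems val_greedy_padded[of m "Suc l"] by simp
  next
    case False
    then show ?thesis using Suc.prems Suc.IH[of "m mod U l"] U_pos
      by (simp add: Suc_diff_le)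
  qed
qed simp

lemma greedy_greedy_padded:
  assumes "U l \<le> n" "n < U (Suc l)"
  shows "greedy U (greedy_padded U (Suc l) n)"
  unfolding greedy_def
proof (intro conjI allI impI)
  show "greedy_padded U (Suc l) n \<in> lists (A_U U)"
    using set_greedy_padded[OF assms(2)] by (auto simp: A_U_def)
  show "hd (greedy_padded U (Suc l) n) \<noteq> 0"
    using assms(1) U_pos[of l] by (simp add: div_eq_0_iff)
  fix t assume "t < length (greedy_padded U (Suc l) n)"
  then show "(\<Sum>i\<le>t. rev (greedy_padded U (Suc l) n) ! i * U i) < U (Suc t)"
    using val_drop_greedy_padded[OF assms(2), of "Suc t"]
    by (subst suffix_sum_eq_val_U) simp_all
qed simp

text \<open>The rest of the word has a value below the weight of the leading digit, so that digit is
  a quotient and the value of the rest is the remainder.\<close>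

lemma eq_greedy_padded:
  assumes "\<And>t. t \<le> length w \<Longrightarrow> val_U U (drop (length w - t) w) < U t"
  shows "w = greedy_padded U (length w) (val_U U w)"
  using assms
proof (induction w)
  case (Cons d w)
  have less: "val_U U (drop (length w - t) w) < U t" if "t \<le> length w" for t
    using Cons.prems[of t] that by (simp add: Suc_diff_le)
  have "w = greedy_padded U (length w) (val_U U w)" using Cons.IH less .
  moreover have "val_U U w < U (length w)" using less[of "length w"] by simp
  ultimately
show ?case using U_pos[of "length w"] by (simp add: val_U_Cons)
qed simp

lemma greedy_eq_greedy_padded:
  assumes "greedy U w"
  shows "w = greedy_padded U (length w) (val_U U w)"
    and "U (length w - 1) \<le> val_U U w" and "val_U U w < U (length w)"
proof -
  have w: "w \<noteq> []" "hd w \<noteq> 0" using assms by (auto simp: greedy_def)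
  have less: "val_U U (drop (length w - t) w) < U t" if "t \<le> length w" for t
  proof (cases t)
    case (Suc s)
    then have "s < length w" using that by simp
    then have "(\<Sum>i\<le>s. rev w ! i * U i) < U (Suc s)" using assms by (simp add: greedy_def)
    then show ?thesis using suffix_sum_eq_val_U[OF \<open>s < length w\<close>] Suc by simp
  qed (simp add: U_0)
  then show "w = greedy_padded U (length w) (val_U U w)" by (rule eq_greedy_padded)
  show "val_U U w < U (length w)" using less[of "length w"] by simp
  show "U (length w - 1) \<le> val_U U w"
    using w by (cases w) (auto simp: val_U_Cons intro: trans_le_add1)
qed

lemma rep_U_eq_greedy_padded:
  assumes "U l \<le> n" "n < U (Suc l)"
  shows "rep_U U n = greedy_padded U (Suc l) n"
proof -
  have "n \<noteq> 0" using assms(1) U_pos[of l] by simp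
  have "(THE w. greedy U w \<and> val_U U w = n) = greedy_padded U (Suc l) n"
  proof (rule the_equality)
    show "greedy U (greedy_padded U (Suc l) n) \<and> val_U U (greedy_padded U (Suc l) n) = n"
      using greedy_greedy_padded[OF assms] val_greedy_padded[OF assms(2)] by simp
    fix w assume w: "greedy U w \<and> val_U U w = n"
    then have *: "w = greedy_padded U (length w) n" "U (length w - 1) \<le> n" "n < U (length w)"
      using greedy_eq_greedy_padded[of w] by auto
    have "U (length w - 1) < U (Suc l)" "U l < U (length w)"
      using * assms by linarith+
    then have "length w = Suc l" by simp
    then show "w = greedy_padded U (Suc l) n" using *(1) by simp
  qed
  then show ?thesis using \<open>n \<noteq> 0\<close> by (simp add: rep_U_def)
qed

lemma U_interval:
  assumes "0 < n" obtains l where "U l \<le> n" "n < U (Suc l)"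
proof -
  define l where "l = (LEAST i. n < U (Suc i))"
  have *: "n < U (Suc l)" unfolding l_def
    by (rule LeastI[of _ n]) (use less_U[of "Suc n"] in linarith)
  moreover have "U l \<le> n"
  proof (cases l)
    case (Suc i)
    then have "\<not> n < U (Suc i)" using not_less_Least[of i "\<lambda>i. n < U (Suc i)"] l_def by simp
    then show ?thesis using Suc by simp
  qed (use assms U_0 in simp)
  ultimately show ?thesis using that by blast
qed

lemma val_rep_U [simp]: "val_U U (rep_U U n) = n"
proof (cases "n = 0")
  case False
  then obtain l where "U l \<le> n" "n < U (Suc l)" using U_interval by blast
  then show ?thesis by (simp only: rep_U_eq_greedy_padded val_greedy_padded)
qed (simp add: rep_U_def)

lemma set_rep_U: "set (rep_U U n) \<subseteq> {..<C_U U}"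
proof (cases "n = 0")
  case False
  then obtain l where "U l \<le> n" "n < U (Suc l)" using U_interval by blast
  then show ?thesis by (simp only: rep_U_eq_greedy_padded set_greedy_padded)
qed (simp add: rep_U_def)

lemma length_rep_U_eq_Suc_iff: "length (rep_U U n) = Suc l \<longleftrightarrow> U l \<le> n \<and> n < U (Suc l)"
proof (cases "n = 0")
  case False
  then obtain i where i: "U i \<le> n" "n < U (Suc i)" using U_interval by blast
  have "i = l" if "U l \<le> n" "n < U (Suc l)"
  proof -
    have "U i < U (Suc l)" "U l < U (Suc i)" using i that by linarith+
    then show ?thesis by simp
  qed
  then show ?thesis using i by (auto simp: rep_U_eq_greedy_padded)
qed (use U_pos[of l] in \<open>simp add: rep_U_def\<close>)

text \<open>Each word of \<open>L\<close> is the representation of its own value, so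
  \<open>val_U\<close> is injective on \<open>L\<close>.\<close>

lemma mem_val_image_iff:
  assumes "L \<subseteq> range (rep_U U)"
  shows "n \<in> val_U U ` L \<longleftrightarrow> rep_U U n \<in> L"
proof
  assume "n \<in> val_U U ` L"
  then obtain w m where "w \<in> L" "w = rep_U U m" "n = val_U U w" using assms by blast
  then show "rep_U U n \<in> L" by simp
qed (use val_rep_U in \<open>force intro: image_eqI\<close>)

lemma greedy_padded_add:
  "x < U l \<Longrightarrow> greedy_padded U (d + l) x = replicate d 0 @ greedy_padded U l x"
proof (induction d)
  case (Suc d)
  have "U l \<le> U (d + l)" by simp
  then have "x < U (d + l)" using Suc.prems by linarith
  then show ?case using Suc by simp
qed simp

text \<open>Since the sum stays below \<open>U (Suc n)\<close>, the greedy expansion takes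
  \<open>U n\<close> once and continues with \<open>x\<close>.\<close>

lemma rep_U_add_leading_one:
  assumes x: "x < U l" and "l \<le> n" and n: "U n + x < U (Suc n)"
  shows "rep_U U (U n + x) = 1 # replicate (n - l) 0 @ greedy_padded U l x"
proof -
  have "U l \<le> U n" using \<open>l \<le> n\<close> by simp
  then have "x < U n" using x by linarith
  then have "(U n + x) div U n = 1" "(U n + x) mod U n = x" using U_pos[of n] by auto
  then show ?thesis
    using rep_U_eq_greedy_padded[of n "U n + x"] n greedy_padded_add[OF x, of "n - l"] \<open>l \<le> n\<close>
    by simp
qed

end

section \<open>Eventual periods\<close>

definition periodic_from :: "nat set \<Rightarrow> nat \<Rightarrow> nat \<Rightarrow> bool" where
  "periodic_from X m p \<longleftrightarrow> (\<forall>n\<ge>m. n \<in> X \<longleftrightarrow> n + p \<in> X)"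

lemma periodic_from_mult: "periodic_from X m p \<Longrightarrow> m \<le> n \<Longrightarrow> n + i * p \<in> X \<longleftrightarrow> n \<in> X"
proof (induction i)
  case (Suc i)
  then have "n + i * p \<in> X \<longleftrightarrow> n + i * p + p \<in> X"
    unfolding periodic_from_def by (meson trans_le_add1)
  then show ?case using Suc by (simp add: ac_simps)
qed simp

lemma periodic_from_cong:
  assumes per: "periodic_from X m p" and "m \<le> x" "m \<le> y" "x mod p = y mod p"
  shows "x \<in> X \<longleftrightarrow> y \<in> X"
  using assms(2-)
proof (induction x y rule: linorder_wlog)
  case (le x y)
  then have "p dvd y - x" by (metis mod_eq_dvd_iff_nat)
  then obtain i where "y = x + i * p" using le(1) by (metis dvd_def le_add_diff_inverse mult.commute)
  then show ?case using periodic_from_mult[OF per, of x i] le by simp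
qed simp

lemma ultimately_periodic_iff:
  "ultimately_periodic X \<longleftrightarrow> (\<exists>m p. 0 < p \<and> periodic_from X m p)"
proof
  assume "ultimately_periodic X"
  then obtain u v where v: "v \<noteq> []" and X: "\<And>n. n \<in> X \<longleftrightarrow> (u \<frown> v\<^sup>\<omega>) n"
    unfolding ultimately_periodic_def by metis
  have "n \<in> X \<longleftrightarrow> n + length v \<in> X" if "length u \<le> n" for n
  proof -
    have "n + length v - length u = n - length u + length v" using that by simp
    then have "(n + length v - length u) mod length v = (n - length u) mod length v" by simp
    then show ?thesis using v that by (simp add: X)
  qed
  then show "\<exists>m p. 0 < p \<and> periodic_from X m p"
    using v unfolding periodic_from_def by (metis length_greater_0_conv)
next
  assume "\<exists>m p. 0 < p \<and> periodic_from X m p"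
  then obtain m p where p: "0 < p" and per: "periodic_from X m p" by blast
  define u where "u = map (\<lambda>n. n \<in> X) [0..<m]"
  define v where "v = map (\<lambda>n. n \<in> X) [m..<m + p]"
  have "n \<in> X \<longleftrightarrow> (u \<frown> v\<^sup>\<omega>) n" for n
  proof (cases "n < m")
    case True
    then show ?thesis by (simp add: u_def conc_def)
  next
    case False
    have "n \<in> X \<longleftrightarrow> m + (n - m) mod p \<in> X"
    proof (rule periodic_from_cong[OF per])
      show "n mod p = (m + (n - m) mod p) mod p"
        using False by (simp add: mod_add_right_eq)
    qed (use False in auto)
    then show ?thesis using False p by (simp add: u_def v_def conc_def iter_def)
  qed
  moreover have "v \<noteq> []" using p by (simp add: v_def)
  ultimately show "ultimately_periodic X" unfolding ultimately_periodic_def by blast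
qed

definition eventual_period :: "nat set \<Rightarrow> nat \<Rightarrow> bool" where
  "eventual_period X p \<longleftrightarrow> 0 < p \<and> (\<exists>m. periodic_from X m p)"

text \<open>Beyond both thresholds, a shift by \<open>D\<close> has the same effect as one by
  \<open>D mod p\<close>, which would be a smaller eventual period unless it is 0.\<close>

lemma least_period_dvd:
  assumes p: "eventual_period X p" and least: "\<And>r. eventual_period X r \<Longrightarrow> p \<le> r"
    and D: "periodic_from X m D"
  shows "p dvd D"
proof (rule ccontr)
  assume "\<not> p dvd D"
  then have pos: "0 < D mod p" by (simp add: dvd_eq_mod_eq_0)
  obtain m' where m': "periodic_from X m' p" and "0 < p"
    using p unfolding eventual_period_def by blast
  have "periodic_from X (max m m') (D mod p)"
    unfolding periodic_from_def
  proof (intro allI impI)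
    fix n assume n: "max m m' \<le> n"
    have "n \<in> X \<longleftrightarrow> n + D \<in> X" using D n unfolding periodic_from_def by (meson max.boundedE)
    also have "\<dots> \<longleftrightarrow> n + D mod p \<in> X"
      by (rule periodic_from_cong[OF m']) (use n in \<open>auto simp: mod_add_right_eq\<close>)
    finally show "n \<in> X \<longleftrightarrow> n + D mod p \<in> X" .
  qed
  then have "p \<le> D mod p" using least pos unfolding eventual_period_def by blast
  then show False using \<open>0 < p\<close> by (meson mod_less_divisor not_less)
qed

text \<open>There are at most \<open>p ^ length a\<close> tuples of \<open>length a\<close>
  consecutive residues, so two of them coincide early, and the recurrence propagates the
  coincidence. The explicit bounds are needed to place the window.\<close>

lemma recurrence_mod_periodic:
  assumes sat: "satisfies_recurrence U a N" and "0 < p"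
  shows "\<exists>M t. M \<le> N + p ^ length a \<and> 0 < t \<and> t \<le> p ^ length a \<and>
    (\<forall>n\<ge>M. U (n + t) mod p = U n mod p)"
proof -
  define k where "k = length a"
  define f where "f n = map (\<lambda>j. U (n + j) mod p) [0..<k]" for n
  have "f ` {N..N + p ^ k} \<subseteq> {xs. set xs \<subseteq> {..<p} \<and> length xs = k}"
    using \<open>0 < p\<close> by (auto simp: f_def)
  then have "card (f ` {N..N + p ^ k}) \<le> p ^ k"
    using card_mono[OF finite_lists_length_eq, of "{..<p}" _ k] by (simp add: card_lists_length_eq)
  then have "\<not> inj_on f {N..N + p ^ k}"
    by (intro pigeonhole) simp
  then obtain x y where xy: "x < y" "N \<le> x" "y \<le> N + p ^ k" "f x = f y"
    unfolding inj_on_def by (metis atLeastAtMost_iff linorder_neqE_nat)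
  have "U (x + i) mod p = U (y + i) mod p" for i
  proof (induction i rule: less_induct)
    case (less i)
    show ?case
    proof (cases "i < k")
      case True
      then show ?thesis using arg_cong[OF xy(4), of "\<lambda>l. l ! i"] by (simp add: f_def)
    next
      case False
      have rec: "int (U (z + i)) = (\<Sum>j<k. a ! j * int (U (z + (i - k + j))))" if "N \<le> z" for z
      proof -
        have "int (U (z + (i - k) + k)) = (\<Sum>j<k. a ! j * int (U (z + (i - k) + j)))"
          using sat that by (simp add: satisfies_recurrence_def k_def)
        then show ?thesis using False by (simp add: add.assoc)
      qed
      have "int (U (x + i)) mod int p = (\<Sum>j<k. a ! j * int (U (x + (i - k + j)))) mod int p"
        using rec xy by simp
      also have "\<dots> = (\<Sum>j<k. a ! j * (int (U (x + (i - k + j))) mod int p)) mod int p"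
        by (subst mod_sum_eq[symmetric]) (simp add: mod_mult_right_eq mod_sum_eq)
      also have "\<dots> = (\<Sum>j<k. a ! j * (int (U (y + (i - k + j))) mod int p)) mod int p"
      proof (intro arg_cong2[where f = "(mod)"] sum.cong refl)
        fix j assume "j \<in> {..<k}"
        then have "U (x + (i - k + j)) mod p = U (y + (i - k + j)) mod p"
          using False by (intro less) auto
        then show "a ! j * (int (U (x + (i - k + j))) mod int p) =
            a ! j * (int (U (y + (i - k + j))) mod int p)"
          by (simp only: zmod_int[symmetric])
      qed
      also have "\<dots> = (\<Sum>j<k. a ! j * int (U (y + (i - k + j)))) mod int p"
        by (rule sym, subst mod_sum_eq[symmetric]) (simp add: mod_mult_right_eq mod_sum_eq)
      also have "\<dots> = int (U (y + i)) mod int p"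
        using rec[of y] xy by simp
      finally show ?thesis by (metis of_nat_eq_iff zmod_int)
    qed
  qed
  then have "U (n + (y - x)) mod p = U n mod p" if "x \<le> n" for n
    using that xy(1) by (metis add.commute add_diff_inverse_nat diff_add_assoc2 le_add_diff_inverse
        less_imp_le_nat not_less)
  then show ?thesis
    using xy by (intro exI[of _ x] exI[of _ "y - x"]) (auto simp: k_def)
qed

section \<open>Runs of the automaton\<close>

definition run :: "dfa \<Rightarrow> nat \<Rightarrow> nat list \<Rightarrow> nat" where
  "run A = foldl (\<lambda>q d. trans A ! q ! d)"

lemma run_Nil [simp]: "run A q [] = q"
  and run_Cons [simp]: "run A q (d # w) = run A (trans A ! q ! d) w"
  and run_append [simp]: "run A q (u @ w) = run A (run A q u) w"
  by (simp_all add: run_def)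

lemma mem_dfa_lang_iff: "w \<in> dfa_lang c A \<longleftrightarrow> set w \<subseteq> {..<c} \<and> run A (init A) w \<in> set (final A)"
  by (auto simp: dfa_lang_def run_def)

lemma step_less:
  assumes "dfa_over c A" "q < length (trans A)" "d < c"
  shows "trans A ! q ! d < length (trans A)"
proof -
  have "trans A ! q \<in> set (trans A)" using assms by simp
  then have "length (trans A ! q) = c" "set (trans A ! q) \<subseteq> {..<length (trans A)}"
    using assms(1) by (auto simp: dfa_over_def)
  then show ?thesis using assms(3) nth_mem by blast
qed

lemma run_less:
  "dfa_over c A \<Longrightarrow> q < length (trans A) \<Longrightarrow> set w \<subseteq> {..<c} \<Longrightarrow> run A q w < length (trans A)"
  by (induction w arbitrary: q) (auto simp: step_less)

locale recognizable = numeration +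
  fixes A :: dfa
  assumes dfa: "dfa_over (C_U U) A" and lang: "dfa_lang (C_U U) A \<subseteq> range (rep_U U)"
begin

definition recognized :: "nat set" where
  "recognized = val_U U ` dfa_lang (C_U U) A"

lemma mem_recognized_iff: "n \<in> recognized \<longleftrightarrow> run A (init A) (rep_U U n) \<in> set (final A)"
  unfolding recognized_def mem_val_image_iff[OF lang] using set_rep_U by (simp add: mem_dfa_lang_iff)

section \<open>The bound on the period\<close>

text \<open>The state reached after the prefix \<open>u\<close> determines which of the \<open>v + z\<close> are recognized.\<close>

definition prefix_values :: "nat \<Rightarrow> nat set" where
  "prefix_values s =
     {v. U s \<le> v \<and> (\<exists>u. \<forall>z<U s. rep_U U (v + z) = u @ greedy_padded U s z)}"

text \<open>The prefix is unique, since \<open>z = 0\<close> already determines it; the choice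
  merely names it.\<close>

definition prefix_of :: "nat \<Rightarrow> nat \<Rightarrow> nat list" where
  "prefix_of s v = (SOME u. \<forall>z<U s. rep_U U (v + z) = u @ greedy_padded U s z)"

lemma rep_U_prefix_of:
  "v \<in> prefix_values s \<Longrightarrow> z < U s \<Longrightarrow> rep_U U (v + z) = prefix_of s v @ greedy_padded U s z"
  unfolding prefix_values_def prefix_of_def by (smt (verit, best) mem_Collect_eq someI_ex)

text \<open>A digit 1 and zeros are put in front of the prefix. The gap leaves room for every
  continuation by \<open>s\<close> digits, so the new word is still greedy.\<close>

lemma prefix_values_add:
  assumes v: "v \<in> prefix_values s" and n: "length (prefix_of s v) + s \<le> n"
    and gap: "U n + (v + U s) \<le> U (Suc n)"
  shows "U n + v \<in> prefix_values s"
proof -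
  define l where "l = length (prefix_of s v) + s"
  have "rep_U U (U n + v + z) = (1 # replicate (n - l) 0 @ prefix_of s v) @ greedy_padded U s z"
    if z: "z < U s" for z
  proof -
    have rep: "rep_U U (v + z) = prefix_of s v @ greedy_padded U s z"
      using rep_U_prefix_of[OF v z] .
    have "0 < v" using v U_pos[of s] by (auto simp: prefix_values_def)
    then have "rep_U U (v + z) \<noteq> []"
      by (metis add_gr_0 less_numeral_extra(3) val_rep_U val_U_Nil)
    then obtain i where i: "l = Suc i" by (metis l_def length_append length_greedy_padded
        length_0_conv not0_implies_Suc rep)
    have "length (rep_U U (v + z)) = Suc i" using i rep by (simp add: l_def)
    then have "U i \<le> v + z" "v + z < U l"
      unfolding length_rep_U_eq_Suc_iff i by auto
    then have "greedy_padded U l (v + z) = prefix_of s v @ greedy_padded U s z"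
      using rep_U_eq_greedy_padded[of i "v + z"] i rep by simp
    moreover have "rep_U U (U n + (v + z)) = 1 # replicate (n - l) 0 @ greedy_padded U l (v + z)"
      using \<open>v + z < U l\<close> n gap z by (intro rep_U_add_leading_one) (auto simp: l_def)
    ultimately show ?thesis by (simp add: add.assoc)
  qed
  then show ?thesis using v unfolding prefix_values_def by (auto intro: trans_le_add2)
qed

lemma U_mem_prefix_values:
  assumes "s \<le> n" "U n + U s \<le> U (Suc n)"
  shows "U n \<in> prefix_values s"
  unfolding prefix_values_def
proof (intro CollectI conjI exI allI impI)
  fix z assume "z < U s"
  then show "rep_U U (U n + z) = (1 # replicate (n - s) 0) @ greedy_padded U s z"
    using assms rep_U_add_leading_one[of z s n] by simp
qed (use assms in simp)

text \<open>If \<open>v\<close> and \<open>v'\<close> lead to the same state, membership agrees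
  after both for all continuations below \<open>U s\<close>. These cover all residues modulo
  \<open>p\<close>, so \<open>v' - v\<close> is an eventual period and the least period divides
  it.\<close>

lemma card_residues_prefix_values_le:
  assumes p: "eventual_period recognized p"
    and least: "\<And>r. eventual_period recognized r \<Longrightarrow> p \<le> r"
    and per: "periodic_from recognized m p" and s: "p \<le> U s" "m \<le> U s"
  shows "card ((\<lambda>v. v mod p) ` prefix_values s) \<le> length (trans A)"
proof -
  define \<sigma> where "\<sigma> v = run A (init A) (prefix_of s v)" for v
  define V where "V = prefix_values s"
  have ge: "m \<le> v" if "v \<in> V" for v
    using that s by (auto simp: V_def prefix_values_def)
  have "p > 0" using p by (simp add: eventual_period_def)
  have same: "v mod p = v' mod p" if v: "v \<in> V" "v' \<in> V" "\<sigma> v = \<sigma> v'" for v v'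
    using v
  proof (induction v v' rule: linorder_wlog)
    case (le v v')
    have eq: "v + z \<in> recognized \<longleftrightarrow> v' + z \<in> recognized" if "z < U s" for z
      using le that by (simp add: mem_recognized_iff rep_U_prefix_of V_def \<sigma>_def)
    have "periodic_from recognized v (v' - v)"
      unfolding periodic_from_def
    proof (intro allI impI)
      fix n assume "v \<le> n"
      then obtain y where n: "n = v + y" using le_Suc_ex by blast
      \<comment> \<open>Reducing \<open>y\<close> modulo \<open>p\<close> brings it within reach of
        \<open>s\<close> digits, where the common state decides.\<close>
      have "y mod p < U s" using \<open>p > 0\<close> s(1) by (meson less_le_trans mod_less_divisor)
      have "n \<in> recognized \<longleftrightarrow> v + y mod p \<in> recognized"
        unfolding n by (rule periodic_from_cong[OF per]) (use ge le in \<open>auto simp: mod_add_right_eq trans_le_add1\<close>)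
      also have "\<dots> \<longleftrightarrow> v' + y mod p \<in> recognized" by (rule eq) fact
      also have "\<dots> \<longleftrightarrow> v' + y \<in> recognized"
        by (rule periodic_from_cong[OF per]) (use ge le in \<open>auto simp: mod_add_right_eq trans_le_add1\<close>)
      finally show "n \<in> recognized \<longleftrightarrow> n + (v' - v) \<in> recognized"
        using le n by (simp add: add.commute)
    qed
    then have "p dvd v' - v" using least_period_dvd[OF p least] by blast
    then show ?case using le by (metis mod_eq_dvd_iff_nat)
  qed simp
  have "\<sigma> v < length (trans A)" if "v \<in> V" for v
  proof -
    have "set (prefix_of s v) \<subseteq> {..<C_U U}"
      using rep_U_prefix_of[of v s 0] that U_pos[of s] set_rep_U[of "v + 0"] by (simp add: V_def)
    then show ?thesis using dfa by (auto simp: \<sigma>_def dfa_over_def intro: run_less[OF dfa])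
  qed
  then have "finite (\<sigma> ` V)" "card (\<sigma> ` V) \<le> length (trans A)"
    using finite_subset[of "\<sigma> ` V" "{..<length (trans A)}"]
      card_mono[of "{..<length (trans A)}" "\<sigma> ` V"] by auto
  moreover have "card ((\<lambda>v. v mod p) ` V) \<le> card (\<sigma> ` V)"
  proof -
    \<comment> \<open>By \<open>same\<close>, the residue is a function of the state;
      \<open>pick\<close> realizes that function.\<close>
    define pick where "pick q = (SOME v. v \<in> V \<and> \<sigma> v = q)" for q
    have "(\<lambda>v. v mod p) ` V \<subseteq> (\<lambda>q. pick q mod p) ` \<sigma> ` V"
    proof
      fix r assume "r \<in> (\<lambda>v. v mod p) ` V"
      then obtain v where v: "v \<in> V" "r = v mod p" by blast
      then have "pick (\<sigma> v) \<in> V \<and> \<sigma> (pick (\<sigma> v)) = \<sigma> v"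
        unfolding pick_def by (intro someI[where P = "\<lambda>x. x \<in> V \<and> \<sigma> x = \<sigma> v"]) auto
      then have "pick (\<sigma> v) mod p = r" using same v by blast
      then show "r \<in> (\<lambda>q. pick q mod p) ` \<sigma> ` V" using v by blast
    qed
    then show ?thesis using \<open>finite (\<sigma> ` V)\<close> surj_card_le by blast
  qed
  ultimately show ?thesis by (simp add: V_def)
qed

lemma period_bound:
  assumes rec: "linear_recurrence_of U a N" and H2: "H2 U" and H3: "H3_from U G"
    and gcd: "Gcd (set a) = 1" and "ultimately_periodic recognized"
  shows "\<exists>m p. 0 < p \<and> p \<le> length (trans A) * (fact (length a) * U (N + 2 * length a) ^ length a) \<and>
    periodic_from recognized m p"
proof -
  \<comment> \<open>(H2) supplies one gap of size at least \<open>B\<close> beyond \<open>G\<close>,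
    and (H3) keeps the later gaps from shrinking.\<close>
  have gaps: "\<exists>n0. \<forall>n\<ge>n0. U n + B \<le> U (Suc n)" for B
  proof -
    have "\<exists>i\<ge>G. U i + B \<le> U (Suc i)"
    proof (rule ccontr)
      assume "\<not> ?thesis"
      then have "real (U (Suc i)) - real (U i) \<le> real B" if "i \<ge> G" for i
        using that by (smt (verit) linorder_not_le less_imp_le_nat of_nat_add of_nat_le_iff)
      then have "eventually (\<lambda>i. ereal (real (U (Suc i)) - real (U i)) \<le> ereal (real B)) sequentially"
        by (auto simp: eventually_sequentially)
      then have "limsup (\<lambda>i. ereal (real (U (Suc i)) - real (U i))) \<le> ereal (real B)"
        by (rule Limsup_bounded)
      then show False using H2 by (simp add: H2_def)
    qed
    then obtain i where i: "i \<ge> G" "U i + B \<le> U (Suc i)" by blast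
    have "U (i + d) + B \<le> U (Suc (i + d))" for d
    proof (induction d)
      case (Suc d)
      have "int (U (i + d + 1)) - int (U (i + d)) \<le> int (U (i + d + 2)) - int (U (i + d + 1))"
        using H3 i(1) unfolding H3_from_def by (meson trans_le_add1)
      then show ?case using Suc by simp
    qed (use i in simp)
    then show ?thesis by (metis le_add_diff_inverse)
  qed
  define p where "p = (LEAST p. eventual_period recognized p)"
  have "\<exists>p. eventual_period recognized p"
    using assms(5) unfolding ultimately_periodic_iff eventual_period_def by blast
  then have p: "eventual_period recognized p" unfolding p_def by (rule LeastI_ex)
  have least: "p \<le> r" if "eventual_period recognized r" for r
    unfolding p_def using that by (rule Least_le)
  obtain m where m: "periodic_from recognized m p" and p0: "p > 0"
    using p unfolding eventual_period_def by blast
  \<comment> \<open>Because \<open>n < U n\<close>, this choice puts \<open>U s\<close> above both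
    the period and the threshold.\<close>
  define s where "s = p + m"
  have s: "p \<le> U s" "m \<le> U s" using less_U[of s] by (auto simp: s_def)
  define Q where "Q = (\<lambda>v. v mod p) ` prefix_values s"
  have finQ: "finite Q" using p0 by (auto simp: Q_def intro: finite_subset[of _ "{..<p}"])
  have cardQ: "card Q \<le> length (trans A)"
    unfolding Q_def by (rule card_residues_prefix_values_le[OF p _ m s]) (rule least)
  \<comment> \<open>The translations that stabilize \<open>Q\<close>. Being closed under addition
    and containing \<open>p\<close>, they form a subgroup modulo \<open>p\<close>.\<close>
  define E where "E = {x. \<forall>r\<in>Q. (r + x) mod p \<in> Q}"
  have E_add: "x + y \<in> E" if "x \<in> E" "y \<in> E" for x y
  proof -
    have "(r + (x + y)) mod p \<in> Q" if "r \<in> Q" for r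
    proof -
      have "(r + x) mod p \<in> Q" using \<open>x \<in> E\<close> that by (simp add: E_def)
      then have "((r + x) mod p + y) mod p \<in> Q" using \<open>y \<in> E\<close> by (simp add: E_def)
      then show ?thesis by (simp add: mod_add_left_eq add.assoc)
    qed
    then show ?thesis by (simp add: E_def)
  qed
  have E_0: "0 \<in> E" by (auto simp: E_def Q_def)
  have E_mult: "i * x \<in> E" if "x \<in> E" for i x
    using that by (induction i) (auto simp: E_0 E_add)
  have E_cong: "y \<in> E" if "x \<in> E" "x mod p = y mod p" for x y
  proof -
    have "(r + x) mod p = (r + y) mod p" for r using that(2) by (rule mod_add_cong[OF refl])
    then show ?thesis using that(1) by (simp add: E_def)
  qed
  have p_E: "p \<in> E" by (rule E_cong[OF E_0]) simp
  obtain M t where t: "0 < t" "\<And>n. n \<ge> M \<Longrightarrow> U (n + t) mod p = U n mod p"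
    using recurrence_mod_periodic[of U a N p] rec p0 by (auto simp: linear_recurrence_of_def)
  have t': "U (n + i * t) mod p = U n mod p" if "n \<ge> M" for n i
  proof (induction i)
    case (Suc i)
    then show ?case using t(2)[of "n + i * t"] that by (simp add: ac_simps)
  qed simp
  have U_E: "U n \<in> E" if n: "n \<ge> M" for n
    unfolding E_def
  proof (intro CollectI ballI)
    fix r assume "r \<in> Q"
    then obtain v where v: "v \<in> prefix_values s" "r = v mod p" by (auto simp: Q_def)
    obtain n0 where n0: "\<And>n. n \<ge> n0 \<Longrightarrow> U n + (v + U s) \<le> U (Suc n)" using gaps by blast
    \<comment> \<open>A term with the same residue as \<open>U n\<close>, but far enough out for a
      gap and for the digits of the prefix.\<close>
    define n' where "n' = n + (n0 + length (prefix_of s v) + s) * t"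
    have "n0 + length (prefix_of s v) + s \<le> n'" using t(1) by (simp add: n'_def trans_le_add2)
    then have "U n' + v \<in> prefix_values s" using n0 by (intro prefix_values_add v) auto
    moreover have "(U n' + v) mod p = (r + U n) mod p"
      using t'[OF n] unfolding v(2) n'_def by (metis add.commute mod_add_left_eq mod_add_right_eq)
    ultimately show "(r + U n) mod p \<in> Q" by (metis Q_def imageI)
  qed
  define e where "e = (LEAST e. e \<in> E \<and> 0 < e)"
  have e: "e \<in> E" "0 < e"
    using LeastI[of "\<lambda>e. e \<in> E \<and> 0 < e" p] p_E p0 by (auto simp: e_def)
  have e_dvd: "e dvd x" if "x \<in> E" for x
  proof -
    \<comment> \<open>Adding \<open>p - 1\<close> copies of \<open>(x div e) * e\<close> subtracts
      it modulo \<open>p\<close>, so \<open>x mod e\<close> lies in \<open>E\<close> and is 0 by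
      minimality of \<open>e\<close>.\<close>
    have "x + (x div e * (p - 1)) * e = x mod e + x div e * e * p"
    proof -
      have "x + (x div e * (p - 1)) * e = x mod e + (x div e * e) * (1 + (p - 1))"
        by (simp add: algebra_simps del: One_nat_def)
      then show ?thesis using p0 by simp
    qed
    then have "(x + (x div e * (p - 1)) * e) mod p = (x mod e) mod p" by simp
    moreover have "x + (x div e * (p - 1)) * e \<in> E" using that e E_add E_mult by blast
    ultimately have "x mod e \<in> E" using E_cong by metis
    moreover have "x mod e < e" using e by simp
    ultimately have "x mod e = 0"
      using not_less_Least[of "x mod e" "\<lambda>e. e \<in> E \<and> 0 < e"] by (auto simp: e_def)
    then show ?thesis by (simp add: dvd_eq_mod_eq_0)
  qed
  have e_le: "e \<le> fact (length a) * U (N + 2 * length a) ^ length a"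
    using common_divisor_of_tail_le[OF rec strict_mono_U U_0 gcd, of M e] e_dvd U_E by blast
  obtain i0 where pe: "p = e * i0" using e_dvd[OF p_E] by blast
  have "i0 \<le> card Q"
  proof -
    obtain n0 where "\<And>n. n \<ge> n0 \<Longrightarrow> U n + U s \<le> U (Suc n)" using gaps by blast
    then have "U (n0 + s) \<in> prefix_values s" by (intro U_mem_prefix_values) auto
    then obtain r0 where r0: "r0 \<in> Q" by (auto simp: Q_def)
    \<comment> \<open>The translates of \<open>r0\<close> by multiples of \<open>e\<close> are
      \<open>p div e\<close> distinct members of \<open>Q\<close>.\<close>
    have "inj_on (\<lambda>i. (r0 + i * e) mod p) {..<i0}"
    proof (rule linorder_inj_onI)
      fix x y assume "x < y" "x \<in> {..<i0}" "y \<in> {..<i0}"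
      show "(r0 + x * e) mod p \<noteq> (r0 + y * e) mod p"
      proof
        assume "(r0 + x * e) mod p = (r0 + y * e) mod p"
        then have "p dvd (r0 + y * e) - (r0 + x * e)"
          using \<open>x < y\<close> by (metis add_left_mono less_imp_le_nat mod_eq_dvd_iff_nat mult_le_mono1)
        then have "p dvd (y - x) * e" by (simp add: diff_mult_distrib)
        then have "i0 dvd y - x" using e by (simp add: pe mult.commute)
        then show False using \<open>x < y\<close> \<open>y \<in> {..<i0}\<close> by (auto dest!: dvd_imp_le)
      qed
    qed auto
    moreover have "(\<lambda>i. (r0 + i * e) mod p) ` {..<i0} \<subseteq> Q"
      using E_mult[OF e(1)] r0 by (auto simp: E_def)
    ultimately show ?thesis using card_inj_on_le[OF _ _ finQ] by fastforce
  qed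
  then have "p \<le> length (trans A) * (fact (length a) * U (N + 2 * length a) ^ length a)"
    unfolding pe using cardQ e_le by (subst mult.commute) (intro mult_le_mono, auto)
  then show ?thesis using m p0 by blast
qed

end

section \<open>Sequences in a shift-invariant space of finite dimension\<close>

text \<open>Real scalars make dimension arguments available for sequences of counts.\<close>

interpretation seq: vector_space "\<lambda>(c :: real) (f :: nat \<Rightarrow> real) n. c * f n"
  by unfold_locales (auto simp: fun_eq_iff algebra_simps)

lemma sum_fun_apply: "(\<Sum>x\<in>S. f x) n = (\<Sum>x\<in>S. f x n)"
  by (induction S rule: infinite_finite_induct) auto

lemma shift_mem_span:
  assumes shift: "\<And>f. f \<in> B \<Longrightarrow> (\<lambda>n. f (Suc n)) \<in> seq.span B" and y: "y \<in> seq.span B"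
  shows "(\<lambda>n. y (Suc n)) \<in> seq.span B"
  using y
proof (induction rule: seq.span_induct_alt)
  case base
  have "(\<lambda>n. (0 :: nat \<Rightarrow> real) (Suc n)) = 0" by (simp add: fun_eq_iff)
  then show ?case using seq.span_zero by metis
next
  case (step c x y)
  have "(\<lambda>n. ((\<lambda>n. c * x n) + y) (Suc n)) = (\<lambda>n. c * x (Suc n)) + (\<lambda>n. y (Suc n))"
    by (simp add: fun_eq_iff)
  then show ?case using step shift seq.span_add seq.span_scale by metis
qed

text \<open>The \<open>K + 1\<close> shifts of \<open>y\<close> lie in a space of dimension at most
  \<open>K\<close>. Only the order of the relation is controlled, not its coefficients.\<close>

lemma shift_span_relation:
  assumes B: "finite B" "card B \<le> K"
    and shift: "\<And>f. f \<in> B \<Longrightarrow> (\<lambda>n. f (Suc n)) \<in> seq.span B" and y: "y \<in> seq.span B"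
  obtains c i where "i \<le> K" "c i \<noteq> 0" "\<And>n. (\<Sum>i\<le>K. c i * y (n + i)) = 0"
proof -
  define Y where "Y i = (\<lambda>n. y (n + i))" for i
  have Y_apply: "Y i n = y (n + i)" for i n by (simp add: Y_def)
  have Y: "Y i \<in> seq.span B" for i
  proof (induction i)
    case (Suc i)
    then show ?case using shift_mem_span[OF shift Suc] by (simp add: Y_def)
  qed (use y in \<open>simp add: Y_def\<close>)
  show thesis
  \<comment> \<open>Linear dependence is stated for sets, which do not see repetitions, so
    coinciding shifts are treated separately.\<close>
  proof (cases "inj_on Y {..K}")
    case False
    then obtain i j where ij: "i \<le> K" "j \<le> K" "i \<noteq> j" "Y i = Y j" by (auto simp: inj_on_def)
    define c where "c l = (if l = i then 1 else if l = j then - 1 else 0 :: real)" for l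
    have "(\<Sum>l\<le>K. c l * y (n + l)) = 0" for n
    proof -
      have "(\<Sum>l\<le>K. c l * y (n + l)) =
          (\<Sum>l\<le>K. (if l = i then y (n + i) else 0) - (if l = j then y (n + j) else 0))"
        using ij(3) by (intro sum.cong) (auto simp: c_def)
      also have "\<dots> = y (n + i) - y (n + j)" using ij by (simp add: sum_subtractf)
      also have "\<dots> = 0" using ij(4) by (simp add: Y_def fun_eq_iff)
      finally show ?thesis .
    qed
    then show ?thesis using that[of i c] ij by (simp add: c_def)
  next
    case True
    have "seq.dependent (Y ` {..K})"
    proof (rule ccontr)
      assume "\<not> ?thesis"
      then have "card (Y ` {..K}) \<le> card B"
        using seq.independent_span_bound[OF B(1), of "Y ` {..K}"] Y by auto
      then show False using True B(2) by (simp add: card_image)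
    qed
    then obtain T u v where T: "finite T" "T \<subseteq> Y ` {..K}" "v \<in> T" "u v \<noteq> 0"
      and sum: "(\<Sum>v\<in>T. (\<lambda>n. u v * v n)) = 0"
      unfolding seq.dependent_explicit by blast
    define c where "c i = (if Y i \<in> T then u (Y i) else 0)" for i
    obtain i where i: "i \<le> K" "v = Y i" using T by auto
    have "(\<Sum>i\<le>K. c i * y (n + i)) = 0" for n
    proof -
      have "(\<Sum>i\<le>K. c i * y (n + i)) = (\<Sum>f\<in>Y ` {..K}. (if f \<in> T then u f else 0) * f n)"
        by (simp add: sum.reindex[OF True] c_def Y_apply)
      also have "\<dots> = (\<Sum>f\<in>T. u f * f n)"
        using T by (intro sum.mono_neutral_cong_right) auto
      also have "\<dots> = 0" using fun_cong[OF sum, of n] by (simp add: sum_fun_apply)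
      finally show ?thesis .
    qed
    then show ?thesis using that[of i c] i T by (simp add: c_def)
  qed
qed

text \<open>The highest nonzero coefficient expresses a term by at most \<open>K\<close> preceding
  ones.\<close>

lemma relation_zero_forward:
  fixes y :: "nat \<Rightarrow> real"
  assumes c: "i \<le> K" "c i \<noteq> 0" and rel: "\<And>n. (\<Sum>i\<le>K. c i * y (n + i)) = 0"
    and zero: "\<And>n. s \<le> n \<Longrightarrow> n < s + K \<Longrightarrow> y n = 0" and "s \<le> n"
  shows "y n = 0"
proof -
  define m where "m = Max {i. i \<le> K \<and> c i \<noteq> 0}"
  have "m \<in> {i. i \<le> K \<and> c i \<noteq> 0}" unfolding m_def using c by (intro Max_in) auto
  then have m: "m \<le> K" "c m \<noteq> 0" by auto
  have above: "c i = 0" if "m < i" "i \<le> K" for i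
  proof (rule ccontr)
    assume "c i \<noteq> 0"
    then have "i \<le> m" unfolding m_def using that by (intro Max_ge) auto
    then show False using that by simp
  qed
  show ?thesis using \<open>s \<le> n\<close>
  proof (induction n rule: less_induct)
    case (less n)
    show ?case
    proof (cases "n < s + K")
      case False
      have "(\<Sum>i\<le>K. c i * y (n - m + i)) = (\<Sum>i\<in>{m}. c i * y (n - m + i))"
      proof (rule sum.mono_neutral_right)
        show "\<forall>i\<in>{..K} - {m}. c i * y (n - m + i) = 0"
        proof
          fix i assume i: "i \<in> {..K} - {m}"
          show "c i * y (n - m + i) = 0"
          proof (cases "i < m")
            case True
            then have "y (n - m + i) = 0" using False m by (intro less) auto
            then show ?thesis by simp
          qed (use i above[of i] in auto)
        qed
      qed (use m in auto)
      then show ?thesis using rel[of "n - m"] m False by simp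
    qed (use zero less in auto)
  qed
qed

text \<open>The lowest nonzero coefficient, at some \<open>l \<le> K\<close>, expresses a term by
  later ones. The first \<open>l\<close> terms are out of its reach, hence
  \<open>K \<le> n\<close>.\<close>

lemma relation_zero_backward:
  fixes y :: "nat \<Rightarrow> real"
  assumes c: "i \<le> K" "c i \<noteq> 0" and rel: "\<And>n. (\<Sum>i\<le>K. c i * y (n + i)) = 0"
    and zero: "\<And>n. T \<le> n \<Longrightarrow> y n = 0" and "K \<le> n"
  shows "y n = 0"
proof -
  define l where "l = Min {i. i \<le> K \<and> c i \<noteq> 0}"
  have "l \<in> {i. i \<le> K \<and> c i \<noteq> 0}" unfolding l_def using c by (intro Min_in) auto
  then have l: "l \<le> K" "c l \<noteq> 0" by auto
  have below: "c i = 0" if "i < l" for i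
  proof (rule ccontr)
    assume "c i \<noteq> 0"
    then have "l \<le> i" unfolding l_def using that l by (intro Min_le) auto
    then show False using that by simp
  qed
  have "\<forall>n\<ge>T - d. l \<le> n \<longrightarrow> y n = 0" for d
  proof (induction d)
    case (Suc d)
    show ?case
    proof (intro allI impI)
      fix n assume n: "T - Suc d \<le> n" "l \<le> n"
      have "(\<Sum>i\<le>K. c i * y (n - l + i)) = (\<Sum>i\<in>{l}. c i * y (n - l + i))"
      proof (rule sum.mono_neutral_right)
        show "\<forall>i\<in>{..K} - {l}. c i * y (n - l + i) = 0"
        proof
          fix i assume i: "i \<in> {..K} - {l}"
          show "c i * y (n - l + i) = 0"
          proof (cases "l < i")
            case True
            then have "T - d \<le> n - l + i" "l \<le> n - l + i" using n by linarith+
            then have "y (n - l + i) = 0" using Suc.IH by blast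
            then show ?thesis by simp
          qed (use i below[of i] in auto)
        qed
      qed (use l in auto)
      then show "y n = 0" using rel[of "n - l"] l n by simp
    qed
  qed (use zero in simp)
  from this[of T] show ?thesis using l \<open>K \<le> n\<close> by simp
qed

section \<open>Counting the elements of a residue class\<close>

lemma card_residue_class:
  assumes "r < p"
  shows "card {m. m < u \<and> m mod p = r} = u div p + of_bool (r < u mod p)"
proof (induction u)
  case (Suc u)
  have "{m. m < Suc u \<and> m mod p = r} =
      (if u mod p = r then insert u {m. m < u \<and> m mod p = r} else {m. m < u \<and> m mod p = r})"
    by (auto simp: less_Suc_eq)
  then have "card {m. m < Suc u \<and> m mod p = r} =
      card {m. m < u \<and> m mod p = r} + of_bool (u mod p = r)" by simp
  then show ?case using Suc assms mod_less_divisor[of p u] by (auto simp: div_Suc mod_Suc)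
qed simp

context recognizable begin

text \<open>A transfer matrix acting on pairs of a state and a residue of the value read so far;
  reducing \<open>v\<close> modulo \<open>p\<close> keeps the pairs finite in number.\<close>

fun count_words :: "nat \<Rightarrow> nat \<Rightarrow> nat \<Rightarrow> nat \<Rightarrow> nat \<Rightarrow> nat" where
  "count_words p r 0 q v = of_bool (q \<in> set (final A) \<and> v mod p = r)"
| "count_words p r (Suc i) q v =
     (\<Sum>d<C_U U. count_words p r i (trans A ! q ! d) ((v + d * U i) mod p))"

lemma count_words_eq_card:
  "count_words p r i q v = card {w. length w = i \<and> set w \<subseteq> {..<C_U U} \<and>
     run A q w \<in> set (final A) \<and> (v + val_U U w) mod p = r}"
proof (induction i arbitrary: q v)
  case 0
  have "{w. length w = 0 \<and> set w \<subseteq> {..<C_U U} \<and> run A q w \<in> set (final A) \<and>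
      (v + val_U U w) mod p = r} = (if q \<in> set (final A) \<and> v mod p = r then {[]} else {})"
    by auto
  then show ?case by simp
next
  case (Suc i)
  define W where "W q v = {w. length w = i \<and> set w \<subseteq> {..<C_U U} \<and>
     run A q w \<in> set (final A) \<and> (v + val_U U w) mod p = r}" for q v
  have fin: "finite (W q v)" for q v
    unfolding W_def by (rule finite_subset[OF _ finite_lists_length_eq[of "{..<C_U U}" i]]) auto
  have "{w. length w = Suc i \<and> set w \<subseteq> {..<C_U U} \<and> run A q w \<in> set (final A) \<and>
      (v + val_U U w) mod p = r} =
    (\<Union>d<C_U U. (#) d ` W (trans A ! q ! d) ((v + d * U i) mod p))" (is "?L = ?R")
  proof (rule Set.set_eqI)
    fix w show "w \<in> ?L \<longleftrightarrow> w \<in> ?R"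
      by (cases w) (auto simp: W_def val_U_Cons mod_add_left_eq add.assoc)
  qed
  moreover have "card ?R = (\<Sum>d<C_U U. card ((#) d ` W (trans A ! q ! d) ((v + d * U i) mod p)))"
    by (rule card_UN_disjoint) (auto simp: fin)
  ultimately show ?case
    by (simp add: Suc.IH W_def card_image)
qed

text \<open>The numbers whose representation has \<open>n + 1\<close> digits, split by residue and
  membership. Then \<open>p\<close> is an eventual period iff, for each \<open>r < p\<close>, one
  choice of \<open>b\<close> gives empty blocks for all large \<open>n\<close>.\<close>

definition block :: "bool \<Rightarrow> nat \<Rightarrow> nat \<Rightarrow> nat \<Rightarrow> nat set" where
  "block b p r n = {m. U n \<le> m \<and> m < U (Suc n) \<and> m mod p = r \<and> (m \<in> recognized \<longleftrightarrow> b)}"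

lemma finite_block [simp]: "finite (block b p r n)"
  by (rule finite_subset[of _ "{..<U (Suc n)}"]) (auto simp: block_def)

text \<open>\<open>rep_U\<close> maps the block onto the accepted words of length
  \<open>Suc n\<close>; it is onto because every accepted word is a representation.\<close>

lemma card_block_True: "card (block True p r n) = count_words p r (Suc n) (init A) 0"
proof -
  have "rep_U U ` block True p r n = {w. length w = Suc n \<and> set w \<subseteq> {..<C_U U} \<and>
     run A (init A) w \<in> set (final A) \<and> (0 + val_U U w) mod p = r}" (is "_ = ?W")
  proof (intro equalityI subsetI)
    fix w assume "w \<in> ?W"
    then have w: "w \<in> dfa_lang (C_U U) A" "length w = Suc n" "val_U U w mod p = r"
      by (auto simp: mem_dfa_lang_iff)
    then obtain m where "w = rep_U U m" using lang by blast
    then show "w \<in> rep_U U ` block True p r n"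
      using w by (auto simp: block_def recognized_def mem_val_image_iff[OF lang]
          length_rep_U_eq_Suc_iff)
  qed (use set_rep_U in \<open>auto simp: block_def mem_recognized_iff length_rep_U_eq_Suc_iff\<close>)
  moreover have "inj_on (rep_U U) (block True p r n)"
    by (rule inj_on_inverseI[of _ "val_U U"]) simp
  ultimately show ?thesis
    unfolding count_words_eq_card by (metis (no_types, lifting) card_image)
qed

text \<open>Non-elements are counted by complement; the additive form avoids truncated
  subtraction.\<close>

lemma card_block_False:
  assumes "r < p"
  shows "card (block False p r n) + card (block True p r n) + (U n div p + of_bool (r < U n mod p)) =
    U (Suc n) div p + of_bool (r < U (Suc n) mod p)"
proof -
  have le: "U n < U (Suc n)" by simp
  have "{m. m < U (Suc n) \<and> m mod p = r} =
      (block False p r n \<union> block True p r n) \<union> {m. m < U n \<and> m mod p = r}"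
    by (auto simp: block_def intro: less_trans[OF _ le])
  moreover have "card \<dots> = card (block False p r n \<union> block True p r n) +
      card {m. m < U n \<and> m mod p = r}"
    by (rule card_Un_disjoint) (auto simp: block_def)
  moreover have "card (block False p r n \<union> block True p r n) =
      card (block False p r n) + card (block True p r n)"
    by (rule card_Un_disjoint) (auto simp: block_def)
  ultimately show ?thesis
    unfolding card_residue_class[OF assms, symmetric] by simp
qed

text \<open>Restricted to the classes modulo the period \<open>t\<close> of \<open>U\<close> modulo \<open>p\<close>, the numbers of words
  accepted from the states, the terms of \<open>U\<close> and the constants span a shift-invariant space, in
  which all the block sizes lie.\<close>

lemma block_relation:
  assumes sat: "satisfies_recurrence U a N" and "r < p" and "N \<le> M" and "0 < t"
    and t: "\<And>n. n \<ge> M \<Longrightarrow> U (n + t) mod p = U n mod p"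
    and K: "t * (length (trans A) * p + length a + 1) \<le> K"
  obtains c i where "i \<le> K" "c i \<noteq> 0"
    "\<And>n. (\<Sum>i\<le>K. c i * real (card (block b p r (M + (n + i))))) = 0"
proof -
  define k where "k = length a"
  define ind :: "nat \<Rightarrow> nat \<Rightarrow> real" where "ind c n = of_bool (n mod t = c)" for c n
  define words where "words = (\<lambda>(q, v, c) n. ind c n * real (count_words p r (M + n) q v))"
  define terms where "terms = (\<lambda>(j, c) n. ind c n * real (U (M + n + j)))"
  define B1 where "B1 = words ` ({..<length (trans A)} \<times> {..<p} \<times> {..<t})"
  define B2 where "B2 = terms ` ({..<k} \<times> {..<t})"
  define B3 where "B3 = ind ` {..<t}"
  define B where "B = B1 \<union> B2 \<union> B3"
  have p: "0 < p" using \<open>r < p\<close> by simp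
  have fin: "finite B" by (simp add: B_def B1_def B2_def B3_def)
  \<comment> \<open>The three families have at most \<open>t * (S * p + k + 1)\<close> members in
    all, with \<open>S\<close> the number of states; this is where \<open>K\<close> comes
    from.\<close>
  have "card B1 \<le> length (trans A) * (p * t)"
    unfolding B1_def by (rule order.trans[OF card_image_le]) (simp_all add: card_cartesian_product)
  moreover have "card B2 \<le> k * t"
    unfolding B2_def by (rule order.trans[OF card_image_le]) (simp_all add: card_cartesian_product)
  moreover have "card B3 \<le> t"
    unfolding B3_def by (rule order.trans[OF card_image_le]) simp_all
  moreover have "card B \<le> card B1 + card B2 + card B3"
    unfolding B_def by (meson card_Un_le add_right_mono order.trans)
  ultimately have cardB: "card B \<le> K" using K by (simp add: k_def algebra_simps)
  have mod_t: "U (M + n) mod p = U (M + n mod t) mod p" for n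
  proof -
    have "U (M + c + i * t) mod p = U (M + c) mod p" for c i
    proof (induction i)
      case (Suc i)
      then show ?case using t[of "M + c + i * t"] by (simp add: ac_simps)
    qed simp
    from this[of "n mod t" "n div t"] show ?thesis by (simp add: add.assoc)
  qed
  \<comment> \<open>The shift of the indicator of a class modulo \<open>t\<close> is the indicator
    of the preceding class.\<close>
  have "\<exists>c'<t. \<forall>n. ind c (Suc n) = ind c' n" if "c < t" for c
  proof -
    define c' where "c' = (c + (t - 1)) mod t"
    have "Suc n mod t = c \<longleftrightarrow> n mod t = c'" for n
    proof
      assume "Suc n mod t = c"
      then have "c' = (Suc n + (t - 1)) mod t" by (metis c'_def mod_add_left_eq)
      then show "n mod t = c'" using \<open>0 < t\<close> by (simp add: add.commute)
    next
      assume "n mod t = c'"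
      then have "Suc n mod t = Suc c' mod t" by (metis mod_Suc_eq)
      also have "\<dots> = (c + t) mod t" unfolding c'_def mod_Suc_eq using \<open>0 < t\<close> by simp
      finally show "Suc n mod t = c" using that by simp
    qed
    then show ?thesis using \<open>0 < t\<close> by (intro exI[of _ c']) (auto simp: ind_def c'_def)
  qed
  then obtain pre where pre: "\<And>c. c < t \<Longrightarrow> pre c < t" "\<And>c n. c < t \<Longrightarrow> ind c (Suc n) = ind (pre c) n"
    by metis
  have words_span: "words (q, v, c) \<in> seq.span B" if "q < length (trans A)" "v < p" "c < t" for q v c
    using that by (intro seq.span_base) (auto simp: B_def B1_def)
  have terms_span: "terms (j, c) \<in> seq.span B" if "j < k" "c < t" for j c
    using that by (intro seq.span_base) (auto simp: B_def B2_def)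
  have ind_span: "ind c \<in> seq.span B" if "c < t" for c
    using that by (intro seq.span_base) (auto simp: B_def B3_def)
  have shift: "(\<lambda>n. f (Suc n)) \<in> seq.span B" if f: "f \<in> B" for f
  proof -
    consider q v c where "f = words (q, v, c)" "q < length (trans A)" "v < p" "c < t"
      | j c where "f = terms (j, c)" "j < k" "c < t"
      | c where "f = ind c" "c < t"
      using f by (auto simp: B_def B1_def B2_def B3_def)
    then show ?thesis
    proof cases
      case 1
      have "f (Suc n) = (\<Sum>d<C_U U. words (trans A ! q ! d, (v + d * U (M + pre c)) mod p, pre c) n)"
        for n
      proof -
        \<comment> \<open>On a single class modulo \<open>t\<close> the residue of the weight
          \<open>U (M + n)\<close> is constant, so the transfer step has constant
          coefficients.\<close>
        have step: "ind (pre c) n * real (count_words p r (M + n) (trans A ! q ! d) ((v + d * U (M + n)) mod p)) =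
          ind (pre c) n * real (count_words p r (M + n) (trans A ! q ! d) ((v + d * U (M + pre c)) mod p))"
          for d
        proof (cases "n mod t = pre c")
          case True
          have "(v + d * U (M + n)) mod p = (v + d * (U (M + n) mod p)) mod p"
            by (metis mod_add_right_eq mod_mult_right_eq)
          also have "\<dots> = (v + d * (U (M + pre c) mod p)) mod p"
            unfolding mod_t[of n] True ..
          also have "\<dots> = (v + d * U (M + pre c)) mod p"
            by (metis mod_add_right_eq mod_mult_right_eq)
          finally show ?thesis by simp
        qed (simp add: ind_def)
        then show ?thesis
          using 1 pre(2)[of c n] by (simp add: words_def sum_distrib_left step)
      qed
      then have "(\<lambda>n. f (Suc n)) =
          (\<Sum>d<C_U U. words (trans A ! q ! d, (v + d * U (M + pre c)) mod p, pre c))"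
        by (simp add: fun_eq_iff sum_fun_apply)
      also have "\<dots> \<in> seq.span B"
        using 1 pre p by (intro seq.span_sum words_span step_less[OF dfa]) auto
      finally show ?thesis .
    next
      case 2
      show ?thesis
      proof (cases "Suc j < k")
        case True
        then have "(\<lambda>n. f (Suc n)) = terms (Suc j, pre c)"
          using 2 pre by (simp add: terms_def fun_eq_iff)
        then show ?thesis using terms_span True pre 2 by simp
      next
        case False
        then have j: "Suc j = k" using 2 by simp
        have rec: "real (U (M + n + k)) = (\<Sum>i<k. real_of_int (a ! i) * real (U (M + n + i)))" for n
        proof -
          have "int (U (M + n + k)) = (\<Sum>i<k. a ! i * int (U (M + n + i)))"
            using sat \<open>N \<le> M\<close> by (simp add: satisfies_recurrence_def k_def)
          then have "real_of_int (int (U (M + n + k))) =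
              real_of_int (\<Sum>i<k. a ! i * int (U (M + n + i)))" by simp
          then show ?thesis by simp
        qed
        have "(\<lambda>n. f (Suc n)) = (\<Sum>i<k. (\<lambda>n. real_of_int (a ! i) * terms (i, pre c) n))"
        proof
          fix n
          have "f (Suc n) = ind (pre c) n * real (U (M + n + k))"
            using 2 pre by (simp add: terms_def flip: j)
          also have "\<dots> = (\<Sum>i<k. real_of_int (a ! i) * terms (i, pre c) n)"
            unfolding rec by (simp add: terms_def sum_distrib_left mult.left_commute)
          finally show "f (Suc n) = (\<Sum>i<k. (\<lambda>n. real_of_int (a ! i) * terms (i, pre c) n)) n"
            by (simp add: sum_fun_apply)
        qed
        also have "\<dots> \<in> seq.span B"
          using 2 pre by (intro seq.span_sum seq.span_scale terms_span) auto
        finally show ?thesis .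
      qed
    next
      case 3
      then have "(\<lambda>n. f (Suc n)) = ind (pre c)" using pre by (simp add: fun_eq_iff)
      then show ?thesis using ind_span pre 3 by simp
    qed
  qed
  have ind_sum: "(\<Sum>c<t. ind c n * x c) = x (n mod t)" for n and x :: "nat \<Rightarrow> real"
    using \<open>0 < t\<close> by (simp add: ind_def of_bool_def if_distrib[of "\<lambda>z. z * _"] cong: if_cong)
  have per_span: "(\<lambda>n. x (n mod t)) \<in> seq.span B" for x :: "nat \<Rightarrow> real"
  proof -
    have "(\<lambda>n. x (n mod t)) = (\<Sum>c<t. (\<lambda>n. x c * ind c n))"
      by (simp add: fun_eq_iff sum_fun_apply ind_sum mult.commute[of "x _"])
    also have "\<dots> \<in> seq.span B" by (intro seq.span_sum seq.span_scale ind_span) auto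
    finally show ?thesis .
  qed
  have U_span: "(\<lambda>n. real (U (M + n))) \<in> seq.span B"
  proof -
    have "(\<lambda>n. real (U (M + n))) = (\<Sum>c<t. terms (0, c))"
      by (simp add: fun_eq_iff sum_fun_apply terms_def sum_distrib_right[symmetric]
          ind_sum[where x = "\<lambda>_. 1", simplified])
    also have "\<dots> \<in> seq.span B"
      using sat by (intro seq.span_sum terms_span) (auto simp: satisfies_recurrence_def k_def)
    finally show ?thesis .
  qed
  have True_span: "(\<lambda>n. real (card (block True p r (M + n)))) \<in> seq.span B"
  proof -
    have "(\<lambda>n. real (count_words p r (M + n) (init A) 0)) = (\<Sum>c<t. words (init A, 0, c))"
      by (simp add: fun_eq_iff sum_fun_apply words_def sum_distrib_right[symmetric]
          ind_sum[where x = "\<lambda>_. 1", simplified])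
    also have "\<dots> \<in> seq.span B"
      using dfa p by (intro seq.span_sum words_span) (auto simp: dfa_over_def)
    \<comment> \<open>Block \<open>n\<close> consists of words of length \<open>Suc n\<close>, hence
      one more shift.\<close>
    finally show ?thesis
      using shift_mem_span[OF shift] by (fastforce simp: card_block_True)
  qed
  have "(\<lambda>n. real p * real (card (block b p r (M + n)))) \<in> seq.span B"
  proof (cases b)
    case True
    then show ?thesis using seq.span_scale[OF True_span] by simp
  next
    case False
    \<comment> \<open>The part of the complement count that depends only on residues of
      \<open>U\<close> and so is periodic in \<open>n\<close>; the factor \<open>p\<close> clears
      the divisions.\<close>
    define x where "x c = real p * (of_bool (r < U (M + Suc c) mod p) - of_bool (r < U (M + c) mod p)) -
      real (U (M + Suc c) mod p) + real (U (M + c) mod p)" for c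
    have x: "x n = x (n mod t)" for n
    proof -
      have "U (M + Suc n) mod p = U (M + Suc (n mod t)) mod p"
        using mod_t[of "Suc n"] mod_t[of "Suc (n mod t)"] by (simp add: mod_Suc_eq)
      then show ?thesis using mod_t[of n] by (simp add: x_def)
    qed
    have "real p * real (card (block False p r (M + n))) = real (U (M + Suc n)) - real (U (M + n)) +
        x n - real p * real (card (block True p r (M + n)))" for n
    proof -
      have div: "real p * real (u div p) = real u - real (u mod p)" for u
        by (metis add_diff_cancel_right' mult_div_mod_eq of_nat_add of_nat_mult)
      have "real p * (real (card (block False p r (M + n))) + real (card (block True p r (M + n))) +
          (real (U (M + n) div p) + of_bool (r < U (M + n) mod p))) =
          real p * (real (U (M + Suc n) div p) + of_bool (r < U (M + Suc n) mod p))"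
        using arg_cong[OF card_block_False[OF \<open>r < p\<close>, of "M + n"], of real] by simp
      then show ?thesis unfolding ring_distribs div x_def by linarith
    qed
    then have "(\<lambda>n. real p * real (card (block b p r (M + n)))) =
        ((\<lambda>n. real (U (M + Suc n))) - (\<lambda>n. real (U (M + n)))) + (\<lambda>n. x (n mod t)) -
        (\<lambda>n. real p * real (card (block True p r (M + n))))"
      using False x by (simp add: fun_eq_iff)
    also have "\<dots> \<in> seq.span B"
      using shift_mem_span[OF shift U_span]
      by (intro seq.span_add seq.span_diff seq.span_scale U_span per_span True_span) simp_all
    finally show ?thesis .
  qed
  then obtain c i where ci: "i \<le> K" "c i \<noteq> 0"
      "\<And>n. (\<Sum>i\<le>K. c i * (real p * real (card (block b p r (M + (n + i)))))) = 0"
    by (rule shift_span_relation[OF fin cardB shift, rotated]) auto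
  have "real p * (\<Sum>i\<le>K. c i * real (card (block b p r (M + (n + i))))) = 0" for n
    using ci(3)[of n] by (simp add: sum_distrib_left mult.left_commute)
  then show ?thesis using that[of i c] ci p by simp
qed

section \<open>The finite test for a given period\<close>

definition periodic_on_window :: "nat \<Rightarrow> nat \<Rightarrow> nat \<Rightarrow> bool" where
  "periodic_on_window p n0 n1 \<longleftrightarrow> (\<forall>x<U n1. \<forall>y<U n1. U n0 \<le> x \<longrightarrow> U n0 \<le> y \<longrightarrow>
     x mod p = y mod p \<longrightarrow> (x \<in> recognized \<longleftrightarrow> y \<in> recognized))"

lemma mem_blockI:
  assumes "U n0 \<le> m" obtains n where "n0 \<le> n" "m \<in> block (m \<in> recognized) p (m mod p) n"
proof -
  have "0 < m" using assms U_pos[of n0] by simp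
  then obtain n where n: "U n \<le> m" "m < U (Suc n)" using U_interval by blast
  then have "U n0 < U (Suc n)" using assms by linarith
  then have "n0 \<le> n" by simp
  then show ?thesis using that[of n] n by (simp add: block_def)
qed

text \<open>The offset \<open>K\<close> in \<open>n0\<close> makes room for propagating eventual
  emptiness of blocks back to \<open>n0\<close>; the window length \<open>K\<close> allows emptiness
  on the window to be propagated forwards.\<close>

lemma window:
  assumes sat: "satisfies_recurrence U a N" and p: "0 < p"
    and K: "K = p ^ length a * (length (trans A) * p + length a + 1)"
    and n0: "n0 = N + p ^ length a + K"
  shows "periodic_on_window p n0 (n0 + K) \<longleftrightarrow> (\<exists>m. periodic_from recognized m p)"
proof -
  define M where "M = N + p ^ length a"
  obtain M' t where t: "M' \<le> M" "0 < t" "t \<le> p ^ length a"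
      "\<And>n. M' \<le> n \<Longrightarrow> U (n + t) mod p = U n mod p"
    using recurrence_mod_periodic[OF sat p] unfolding M_def by blast
  have K': "t * (length (trans A) * p + length a + 1) \<le> K"
    unfolding K by (intro mult_right_mono t) simp
  have NM: "N \<le> M" by (simp add: M_def)
  have tM: "U (n + t) mod p = U n mod p" if "n \<ge> M" for n using t that by simp
  have forward: "block b p r n = {}"
    if "r < p" "n0 \<le> n" "\<And>n. n0 \<le> n \<Longrightarrow> n < n0 + K \<Longrightarrow> block b p r n = {}" for b r n
  proof -
    obtain c i where ci: "i \<le> K" "c i \<noteq> 0"
      "\<And>n. (\<Sum>i\<le>K. c i * real (card (block b p r (M + (n + i))))) = 0"
      using block_relation[OF sat \<open>r < p\<close> NM t(2) tM K'] by metis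
    have "real (card (block b p r (M + (n - M)))) = 0"
    proof (rule relation_zero_forward[where y = "\<lambda>n. real (card (block b p r (M + n)))" and
          s = K and c = c and i = i and n = "n - M", OF ci])
      fix m assume "K \<le> m" "m < K + K"
      then have "block b p r (M + m) = {}" using n0 by (intro that(3)) (auto simp: M_def)
      then show "real (card (block b p r (M + m))) = 0" by simp
    qed (use that n0 in \<open>auto simp: M_def\<close>)
    then show ?thesis using that n0 by (simp add: M_def)
  qed
  have backward: "block b p r n = {}"
    if "r < p" "n0 \<le> n" "\<And>n. T \<le> n \<Longrightarrow> block b p r n = {}" for b r n T
  proof -
    obtain c i where ci: "i \<le> K" "c i \<noteq> 0"
      "\<And>n. (\<Sum>i\<le>K. c i * real (card (block b p r (M + (n + i))))) = 0"
      using block_relation[OF sat \<open>r < p\<close> NM t(2) tM K'] by metis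
    have "real (card (block b p r (M + (n - M)))) = 0"
      by (rule relation_zero_backward[where y = "\<lambda>n. real (card (block b p r (M + n)))" and
          c = c and i = i and n = "n - M" and T = T, OF ci])
        (use that n0 in \<open>auto simp: M_def\<close>)
    then show ?thesis using that n0 by (simp add: M_def)
  qed
  have class_const: "z \<in> recognized \<longleftrightarrow> \<not> b"
    if empty: "\<And>n. n0 \<le> n \<Longrightarrow> block b p r n = {}" and z: "U n0 \<le> z" "z mod p = r" for b r z
  proof -
    obtain n where n: "n0 \<le> n" "z \<in> block (z \<in> recognized) p (z mod p) n"
      using mem_blockI[OF z(1)] .
    show ?thesis
    proof
      show "\<not> b" if "z \<in> recognized" using n empty[OF n(1)] z(2) that by auto
      show "z \<in> recognized" if "\<not> b"
      proof (rule ccontr)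
        assume "z \<notin> recognized"
        then show False using n empty[OF n(1)] z(2) that by simp
      qed
    qed
  qed
  show ?thesis
  proof
    assume win: "periodic_on_window p n0 (n0 + K)"
    have "x \<in> recognized \<longleftrightarrow> x + p \<in> recognized" if x: "U n0 \<le> x" for x
    proof -
      define r where "r = x mod p"
      have "r < p" using p by (simp add: r_def)
      \<comment> \<open>Otherwise the window would contain an element and a non-element of the same
        class.\<close>
      have "\<exists>b. \<forall>n. n0 \<le> n \<and> n < n0 + K \<longrightarrow> block b p r n = {}"
      proof (rule ccontr)
        assume "\<not> ?thesis"
        then obtain n n' x y where "n0 \<le> n" "n < n0 + K" "x \<in> block True p r n"
            "n0 \<le> n'" "n' < n0 + K" "y \<in> block False p r n'"
          by (metis all_not_in_conv)
        then have le: "U n0 \<le> U n" "U (Suc n) \<le> U (n0 + K)" "U n0 \<le> U n'" "U (Suc n') \<le> U (n0 + K)"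
          and xy: "U n \<le> x" "x < U (Suc n)" "U n' \<le> y" "y < U (Suc n')"
            "x mod p = y mod p" "x \<in> recognized" "y \<notin> recognized"
          by (auto simp: block_def)
        have "U n0 \<le> x" "x < U (n0 + K)" "U n0 \<le> y" "y < U (n0 + K)"
          using le xy(1-4) by linarith+
        with xy(5-7) show False
          using win unfolding periodic_on_window_def by blast
      qed
      then obtain b where "\<And>n. n0 \<le> n \<Longrightarrow> n < n0 + K \<Longrightarrow> block b p r n = {}" by blast
      then have "block b p r n = {}" if "n0 \<le> n" for n
        using forward[OF \<open>r < p\<close> that] by blast
      note const = class_const[OF this]
      have "x \<in> recognized \<longleftrightarrow> \<not> b" by (rule const) (use x r_def in auto)
      moreover have "x + p \<in> recognized \<longleftrightarrow> \<not> b" by (rule const) (use x r_def in auto)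
      ultimately show ?thesis by blast
    qed
    then show "\<exists>m. periodic_from recognized m p" by (auto simp: periodic_from_def)
  next
    assume "\<exists>m. periodic_from recognized m p"
    then obtain m where m: "periodic_from recognized m p" by blast
    show "periodic_on_window p n0 (n0 + K)"
      unfolding periodic_on_window_def
    proof (intro allI impI)
      fix x y assume xy: "U n0 \<le> x" "U n0 \<le> y" "x mod p = y mod p"
      define r where "r = x mod p"
      have "r < p" using p by (simp add: r_def)
      \<comment> \<open>The number \<open>r + m * p\<close> is a member of the class beyond
        \<open>m\<close>, so it tells which kind of block dies out.\<close>
      define b where "b \<longleftrightarrow> r + m * p \<notin> recognized"
      have "block b p r n = {}" if "m \<le> n" for n
      proof -
        have "m \<le> U n" using that less_U[of n] by simp
        have "z \<in> recognized \<longleftrightarrow> \<not> b" if "U n \<le> z" "z mod p = r" for z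
          unfolding b_def not_not
        proof (rule periodic_from_cong[OF m])
          show "m \<le> r + m * p" using p by (simp add: trans_le_add2)
        qed (use that \<open>m \<le> U n\<close> \<open>r < p\<close> in auto)
        then show ?thesis by (auto simp: block_def)
      qed
      then have "block b p r n = {}" if "n0 \<le> n" for n
        using backward[OF \<open>r < p\<close> that] by blast
      note const = class_const[OF this]
      have "x \<in> recognized \<longleftrightarrow> \<not> b" by (rule const) (use xy r_def in auto)
      moreover have "y \<in> recognized \<longleftrightarrow> \<not> b" by (rule const) (use xy r_def in auto)
      ultimately show "x \<in> recognized \<longleftrightarrow> y \<in> recognized" by blast
    qed
  qed
qed

end

section \<open>The decision procedure\<close>

text \<open>The single input is padded with zeros to the prefix length that the program
  expects.\<close>

lemma computable_unary_program:
  assumes "computable (\<lambda>e. F (e 0))"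
  shows "\<exists>p. \<forall>x. rec_eval p [x] (F x)"
proof -
  obtain p n where p: "\<And>e m. n \<le> m \<Longrightarrow> rec_eval p (map e [0..<m]) (F (e 0))"
    using assms unfolding computable_def by blast
  have "rec_eval (Comp p (Proj 0 # replicate n Zero)) [x] (F x)" for x
  proof (rule rec_eval.comp)
    define e where "e i = (if i = 0 then x else 0)" for i :: nat
    show "rec_eval p (map e [0..<Suc n]) (F x)"
      using p[of "Suc n" e] by (simp add: e_def del: upt_Suc)
    show "\<forall>i<length (Proj 0 # replicate n Zero). rec_eval ((Proj 0 # replicate n Zero) ! i) [x]
        (map e [0..<Suc n] ! i)"
    proof (intro allI impI)
      fix i assume i: "i < length (Proj 0 # replicate n Zero)"
      then have "map e [0..<Suc n] ! i = e i" by (simp del: upt_Suc)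
      then show "rec_eval ((Proj 0 # replicate n Zero) ! i) [x] (map e [0..<Suc n] ! i)"
        using i rec_eval.proj[of 0 "[x]"] rec_eval.zero by (cases i) (auto simp: e_def)
    qed
  qed simp
  then show ?thesis by blast
qed

section \<open>Evaluation of the coded instance\<close>

definition positive_part :: "nat \<Rightarrow> nat" where
  "positive_part c = (if c mod 2 = 0 then c div 2 else 0)"

definition negative_part :: "nat \<Rightarrow> nat" where
  "negative_part c = (if c mod 2 = 0 then 0 else Suc (c div 2))"

lemma parts_int_encode:
  "int (positive_part (int_encode z)) - int (negative_part (int_encode z)) = z"
  by (simp add: positive_part_def negative_part_def int_encode_def sum_encode_def)

lemma computable_positive_part [computable_intros]:
  assumes "computable f" shows "computable (\<lambda>e. positive_part (f e))"
  unfolding positive_part_def by (intro computable_intros assms)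

lemma computable_negative_part [computable_intros]:
  assumes "computable f" shows "computable (\<lambda>e. negative_part (f e))"
  unfolding negative_part_def by (intro computable_intros assms)

definition code_order :: "nat \<Rightarrow> nat" where
  "code_order x = code_length (code_nth x 0)"

definition code_initial :: "nat \<Rightarrow> nat" where
  "code_initial x = code_length (code_nth x 1)"

definition code_trans :: "nat \<Rightarrow> nat" where
  "code_trans x = code_nth (code_nth x 3) 1"

definition code_final :: "nat \<Rightarrow> nat" where
  "code_final x = code_nth (code_nth x 3) 2"

lemma computable_code_order [computable_intros]:
  assumes "computable f" shows "computable (\<lambda>e. code_order (f e))"
  unfolding code_order_def by (intro computable_intros assms)

lemma computable_code_initial [computable_intros]:
  assumes "computable f" shows "computable (\<lambda>e. code_initial (f e))"
  unfolding code_initial_def by (intro computable_intros assms)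

lemma computable_code_trans [computable_intros]:
  assumes "computable f" shows "computable (\<lambda>e. code_trans (f e))"
  unfolding code_trans_def by (intro computable_intros assms)

lemma computable_code_final [computable_intros]:
  assumes "computable f" shows "computable (\<lambda>e. code_final (f e))"
  unfolding code_final_def by (intro computable_intros assms)

text \<open>\<open>code_next x m r\<close> is \<open>U m\<close>, computed from the code \<open>r\<close> of the list of the earlier terms,
  latest first.\<close>

definition code_next :: "nat \<Rightarrow> nat \<Rightarrow> nat \<Rightarrow> nat" where
  "code_next x m r = (if m < code_initial x then code_nth (code_nth x 1) m
     else (\<Sum>j<code_order x. positive_part (code_nth (code_nth x 0) j) *
             code_nth r (code_order x - 1 - j)) -
          (\<Sum>j<code_order x. negative_part (code_nth (code_nth x 0) j) *
             code_nth r (code_order x - 1 - j)))"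

lemma computable_code_next [computable_intros]:
  assumes "computable f" "computable g" "computable h"
  shows "computable (\<lambda>e. code_next (f e) (g e) (h e))"
  by (rule computable_comp3[OF _ assms]) (unfold code_next_def, intro computable_intros)

text \<open>Course-of-values recursion: primitive recursion hands on one number, so the list of all
  earlier terms is carried as a code.\<close>

definition code_history :: "nat \<Rightarrow> nat \<Rightarrow> nat" where
  "code_history x = rec_nat 0 (\<lambda>m r. Suc (prod_encode (code_next x m r, r)))"

definition code_term :: "nat \<Rightarrow> nat \<Rightarrow> nat" where
  "code_term x n = code_nth (code_history x (Suc n)) 0"

lemma computable_code_term [computable_intros]:
  assumes "computable f" "computable g" shows "computable (\<lambda>e. code_term (f e) (g e))"
  by (rule computable_comp2[OF _ assms])
    (unfold code_term_def code_history_def, intro computable_intros)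

text \<open>Since \<open>i < U i\<close>, indices beyond \<open>n\<close> cannot contribute.\<close>

definition code_rep_length :: "nat \<Rightarrow> nat \<Rightarrow> nat" where
  "code_rep_length x n = (\<Sum>i<Suc n. if code_term x i \<le> n then 1 else 0)"

lemma computable_code_rep_length [computable_intros]:
  assumes "computable f" "computable g" shows "computable (\<lambda>e. code_rep_length (f e) (g e))"
  by (rule computable_comp2[OF _ assms]) (unfold code_rep_length_def, intro computable_intros)

text \<open>\<open>greedy_padded\<close> recurses with a changing parameter; here the remainder is
  the accumulator, so primitive recursion applies.\<close>

definition code_remainder :: "nat \<Rightarrow> nat \<Rightarrow> nat \<Rightarrow> nat" where
  "code_remainder x n = rec_nat n (\<lambda>i r. r mod code_term x (code_rep_length x n - 1 - i))"

lemma computable_code_remainder [computable_intros]: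
  assumes "computable f" "computable g" "computable h"
  shows "computable (\<lambda>e. code_remainder (f e) (g e) (h e))"
  by (rule computable_comp3[OF _ assms]) (unfold code_remainder_def, intro computable_intros)

definition code_state :: "nat \<Rightarrow> nat \<Rightarrow> nat \<Rightarrow> nat" where
  "code_state x n = rec_nat (code_nth (code_nth x 3) 0) (\<lambda>i q. code_nth (code_nth (code_trans x) q)
     (code_remainder x n i div code_term x (code_rep_length x n - 1 - i)))"

lemma computable_code_state [computable_intros]:
  assumes "computable f" "computable g" "computable h"
  shows "computable (\<lambda>e. code_state (f e) (g e) (h e))"
  by (rule computable_comp3[OF _ assms]) (unfold code_state_def, intro computable_intros)

definition code_accepts :: "nat \<Rightarrow> nat \<Rightarrow> bool" where
  "code_accepts x n \<longleftrightarrow> (\<exists>i<code_length (code_final x).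
     code_nth (code_final x) i = code_state x n (code_rep_length x n))"

lemma decidable_code_accepts [computable_intros]:
  assumes "computable f" "computable g" shows "decidable (\<lambda>e. code_accepts (f e) (g e))"
  \<comment> \<open>Below the bounded quantifier the arguments are evaluated in a shifted
    environment, to which \<open>computable_subst\<close> carries them.\<close>
  unfolding code_accepts_def by (intro computable_intros assms computable_subst[OF assms(1)]
      computable_subst[OF assms(2)])

definition window_length :: "nat \<Rightarrow> nat \<Rightarrow> nat" where
  "window_length x p =
     p ^ code_order x * (code_length (code_trans x) * p + code_order x + 1)"

lemma computable_window_length [computable_intros]:
  assumes "computable f" "computable g" shows "computable (\<lambda>e. window_length (f e) (g e))"
  unfolding window_length_def by (intro computable_intros assms)

text \<open>\<open>code_initial x - code_order x\<close> recovers \<open>N\<close> from the number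
  of initial terms.\<close>

definition window_start :: "nat \<Rightarrow> nat \<Rightarrow> nat" where
  "window_start x p = code_initial x - code_order x + p ^ code_order x + window_length x p"

lemma computable_window_start [computable_intros]:
  assumes "computable f" "computable g" shows "computable (\<lambda>e. window_start (f e) (g e))"
  unfolding window_start_def by (intro computable_intros assms)

definition code_window_bound :: "nat \<Rightarrow> nat \<Rightarrow> nat" where
  "code_window_bound x p = code_term x (window_start x p + window_length x p)"

lemma computable_code_window_bound [computable_intros]:
  assumes "computable f" "computable g" shows "computable (\<lambda>e. code_window_bound (f e) (g e))"
  unfolding code_window_bound_def by (intro computable_intros assms)

definition code_period_bound :: "nat \<Rightarrow> nat" where
  "code_period_bound x = code_length (code_trans x) *
     (fact (code_order x) * code_term x (code_initial x + code_order x) ^ code_order x)"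

lemma computable_code_period_bound [computable_intros]:
  assumes "computable f" shows "computable (\<lambda>e. code_period_bound (f e))"
  unfolding code_period_bound_def by (intro computable_intros assms)

definition decide_periodic :: "nat \<Rightarrow> nat" where
  "decide_periodic x = (if \<exists>p<Suc (code_period_bound x). 0 < p \<and>
     (\<forall>y<code_window_bound x p. \<forall>z<code_window_bound x p.
        code_term x (window_start x p) \<le> y \<longrightarrow> code_term x (window_start x p) \<le> z \<longrightarrow>
        y mod p = z mod p \<longrightarrow> (code_accepts x y \<longleftrightarrow> code_accepts x z)) then 1 else 0)"

lemma computable_decide_periodic: "computable (\<lambda>e. decide_periodic (e 0))"
  unfolding decide_periodic_def by (intro computable_intros)

section \<open>Correctness of the procedure\<close>

locale problem_instance = recognizable +
  fixes a :: "int list" and N G x :: nat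
  assumes sat: "satisfies_recurrence U a N"
    and x: "x = encode_instance a (map U [0..<N + length a]) G A"
begin

lemma code_nth_x:
  "code_nth x 0 = list_encode (map int_encode a)"
  "code_nth x (Suc 0) = list_encode (map U [0..<N + length a])"
  "code_nth (code_nth x 3) 0 = init A"
  "code_nth (code_nth x 3) (Suc 0) = list_encode (map list_encode (trans A))"
  "code_nth (code_nth x 3) 2 = list_encode (final A)"
  unfolding x encode_instance_def encode_dfa_def
  by (simp_all add: numeral_2_eq_2 numeral_3_eq_3 del: list_encode.simps)

lemma code_order [simp]: "code_order x = length a"
  and code_initial [simp]: "code_initial x = N + length a"
  and code_length_trans [simp]: "code_length (code_trans x) = length (trans A)"
  by (simp_all add: code_order_def code_initial_def code_trans_def code_nth_x
      del: list_encode.simps)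

lemma code_history: "code_history x n = list_encode (map U (rev [0..<n]))"
proof (induction n)
  case (Suc n)
  define k where "k = length a"
  define r where "r = list_encode (map U (rev [0..<n]))"
  have "code_next x n r = U n"
  proof (cases "n < N + k")
    case True
    then show ?thesis by (simp add: code_next_def code_nth_x k_def del: list_encode.simps)
  next
    case False
    have "k \<ge> 1" using sat by (simp add: satisfies_recurrence_def k_def)
    define P where "P = (\<Sum>j<k. positive_part (int_encode (a ! j)) * U (n - k + j))"
    define Q where "Q = (\<Sum>j<k. negative_part (int_encode (a ! j)) * U (n - k + j))"
    \<comment> \<open>The history lists the latest term first, so \<open>U (n - 1)\<close> is at
      position 0.\<close>
    have r: "code_nth r (k - Suc j) = U (n - k + j)" if "j < k" for j
      using that False by (simp add: r_def rev_nth algebra_simps del: list_encode.simps)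
    \<comment> \<open>The truncated subtraction is exact, because the integer difference is
      \<open>U n\<close>.\<close>
    have "code_next x n r = P - Q"
      using False by (simp add: code_next_def P_def Q_def code_nth_x r k_def[symmetric]
          del: list_encode.simps)
    moreover have "int (U n) = int P - int Q"
    proof -
      have "int (U (n - k + k)) = (\<Sum>j<k. a ! j * int (U (n - k + j)))"
      proof -
        have "N \<le> n - k" using False by simp
        then show ?thesis using sat unfolding satisfies_recurrence_def k_def by blast
      qed
      also have "\<dots> = (\<Sum>j<k. (int (positive_part (int_encode (a ! j))) -
          int (negative_part (int_encode (a ! j)))) * int (U (n - k + j)))"
        by (simp add: parts_int_encode)
      finally show ?thesis
        using False by (simp add: P_def Q_def left_diff_distrib sum_subtractf)
    qed
    ultimately show ?thesis by simp
  qed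
  then show ?case using Suc by (simp add: code_history_def r_def)
qed (simp add: code_history_def)

lemma code_term [simp]: "code_term x n = U n"
  unfolding code_term_def code_history by (simp del: list_encode.simps add: rev_nth)

lemma greedy_padded_code_rep_length:
  "n < U (code_rep_length x n)"
  "rep_U U n = greedy_padded U (code_rep_length x n) n"
proof -
  have "n < U (code_rep_length x n) \<and> rep_U U n = greedy_padded U (code_rep_length x n) n"
  proof (cases "n = 0")
    case True
    then show ?thesis by (simp add: code_rep_length_def U_0 rep_U_def)
  next
    case False
    then obtain l where l: "U l \<le> n" "n < U (Suc l)" using U_interval by blast
    have "U i \<le> n \<longleftrightarrow> i \<le> l" for i
    proof
      assume "U i \<le> n"
      then have "U i < U (Suc l)" using l by linarith
      then show "i \<le> l" by simp
    next
      assume "i \<le> l"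
      then have "U i \<le> U l" by simp
      then show "U i \<le> n" using l by linarith
    qed
    moreover have "l \<le> n" using less_U[of l] l by linarith
    ultimately have "code_rep_length x n = (\<Sum>i<Suc l. 1)"
      unfolding code_rep_length_def code_term
      by (intro sum.mono_neutral_cong_right) auto
    then have "code_rep_length x n = Suc l" by simp
    then show ?thesis using l rep_U_eq_greedy_padded[OF l] by metis
  qed
  then show "n < U (code_rep_length x n)" "rep_U U n = greedy_padded U (code_rep_length x n) n"
    by auto
qed

text \<open>Joint invariant: the digits still unread are the greedy expansion of the current
  remainder.\<close>

lemma code_state:
  assumes "j \<le> code_rep_length x n"
  shows "code_state x n j = run A (init A) (take j (rep_U U n)) \<and>
    drop j (rep_U U n) = greedy_padded U (code_rep_length x n - j) (code_remainder x n j)"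
  using assms
proof (induction j)
  case 0
  then show ?case
    using greedy_padded_code_rep_length(2)[of n]
    by (simp add: code_state_def code_remainder_def code_nth_x)
next
  case (Suc j)
  define l where "l = code_rep_length x n"
  define w where "w = rep_U U n"
  have "l - j = Suc (l - 1 - j)" using Suc.prems by (simp add: l_def)
  then have drop: "drop j w = (code_remainder x n j div U (l - 1 - j)) #
      greedy_padded U (l - 1 - j) (code_remainder x n j mod U (l - 1 - j))"
    using Suc by (simp add: w_def l_def)
  have "j < length w"
    using Suc.prems greedy_padded_code_rep_length(2)[of n] by (simp add: w_def)
  then have w: "w ! j = code_remainder x n j div U (l - 1 - j)"
      "drop (Suc j) w = greedy_padded U (l - 1 - j) (code_remainder x n j mod U (l - 1 - j))"
    using drop by (simp_all add: Cons_nth_drop_Suc[symmetric])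
  define q where "q = run A (init A) (take j w)"
  have "set w \<subseteq> {..<C_U U}" using set_rep_U by (simp add: w_def)
  then have d: "w ! j < C_U U" "set (take j w) \<subseteq> {..<C_U U}"
    using \<open>j < length w\<close> nth_mem set_take_subset[of j w] by blast+
  then have q: "q < length (trans A)"
    using run_less[OF dfa] dfa by (simp add: q_def dfa_over_def)
  have row: "length (trans A ! q) = C_U U" using dfa q by (simp add: dfa_over_def)
  have "code_state x n (Suc j) = code_nth (code_nth (code_trans x) (code_state x n j)) (w ! j)"
    by (simp add: code_state_def w l_def)
  also have "\<dots> = trans A ! q ! (w ! j)"
    using Suc q d row by (simp add: q_def w_def code_trans_def code_nth_x del: list_encode.simps)
  also have "\<dots> = run A (init A) (take (Suc j) w)"
    using \<open>j < length w\<close> by (simp add: take_Suc_conv_app_nth q_def)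
  finally show ?case
    using w(2) by (simp add: code_remainder_def w_def l_def)
qed

lemma code_accepts [simp]: "code_accepts x n \<longleftrightarrow> n \<in> recognized"
proof -
  have "length (rep_U U n) = code_rep_length x n"
    by (metis greedy_padded_code_rep_length(2) length_greedy_padded)
  then have "code_state x n (code_rep_length x n) = run A (init A) (rep_U U n)"
    using code_state[of "code_rep_length x n" n] by simp
  then show ?thesis
    unfolding code_accepts_def mem_recognized_iff code_final_def code_nth_x
    by (auto simp: in_set_conv_nth simp del: list_encode.simps)
qed

lemma decide_periodic:
  assumes rec: "linear_recurrence_of U a N" and "H2 U" "H3_from U G" "Gcd (set a) = 1"
  shows "decide_periodic x = (if ultimately_periodic recognized then 1 else 0)"
proof -
  have window: "periodic_on_window p (window_start x p) (window_start x p + window_length x p) \<longleftrightarrow>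
      (\<exists>m. periodic_from recognized m p)" if "0 < p" for p
    by (rule window[OF sat that]) (simp_all add: window_length_def window_start_def)
  have "decide_periodic x = (if \<exists>p<Suc (code_period_bound x). 0 < p \<and>
      periodic_on_window p (window_start x p) (window_start x p + window_length x p) then 1 else 0)"
    by (simp only: decide_periodic_def periodic_on_window_def code_window_bound_def code_term
        code_accepts)
  also have "(\<exists>p<Suc (code_period_bound x). 0 < p \<and>
      periodic_on_window p (window_start x p) (window_start x p + window_length x p)) \<longleftrightarrow>
      (\<exists>p<Suc (code_period_bound x). 0 < p \<and> (\<exists>m. periodic_from recognized m p))"
    using window by blast
  also have "\<dots> \<longleftrightarrow> ultimately_periodic recognized"
  proof
    assume per: "ultimately_periodic recognized"
    have "code_period_bound x =
        length (trans A) * (fact (length a) * U (N + 2 * length a) ^ length a)"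
      by (simp add: code_period_bound_def mult_2 add.assoc)
    then show "\<exists>p<Suc (code_period_bound x). 0 < p \<and> (\<exists>m. periodic_from recognized m p)"
      using period_bound[OF rec assms(2-4) per] by (auto simp: less_Suc_eq_le)
  qed (auto simp: ultimately_periodic_iff)
  finally show ?thesis .
qed

end

theorem theorem5p1:
  shows "\<exists>p. \<forall>(U :: nat \<Rightarrow> nat) (a :: int list) (N :: nat) (G :: nat) (A :: dfa).
    numeration_system U \<and> linear_recurrence_of U a N \<and>
    H1 U \<and> H2 U \<and> H3_from U G \<and> Gcd (set a) = 1 \<and>
    dfa_over (C_U U) A \<and> dfa_lang (C_U U) A \<subseteq> range (rep_U U) \<longrightarrow>
    rec_eval p [encode_instance a (map U [0..<N + length a]) G A]
      (if ultimately_periodic (val_U U ` dfa_lang (C_U U) A) then 1 else 0)"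
proof -
  \<comment> \<open>The program is fixed before any instance is given.\<close>
  obtain p where p: "\<And>x. rec_eval p [x] (decide_periodic x)"
    using computable_unary_program[OF computable_decide_periodic] by blast
  have "rec_eval p [encode_instance a (map U [0..<N + length a]) G A]
      (if ultimately_periodic (val_U U ` dfa_lang (C_U U) A) then 1 else 0)"
    if hyps: "numeration_system U" "linear_recurrence_of U a N" "H2 U" "H3_from U G"
      "Gcd (set a) = 1" "dfa_over (C_U U) A" "dfa_lang (C_U U) A \<subseteq> range (rep_U U)"
    for U a N G A
  proof -
    define x where "x = encode_instance a (map U [0..<N + length a]) G A"
    interpret problem_instance U A a N G x
      using hyps by unfold_locales (auto simp: linear_recurrence_of_def x_def)
    show ?thesis
      using p[of x] decide_periodic[OF hyps(2-5)] unfolding recognized_def x_def by simp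
  qed
  then show ?thesis by blast
qed

end
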